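(* Let $G$ be a compact Lie group and let $\mathcal{C}$ be a set of closed subgroups of $G$ which is closed under conjugacy. If $i: A \to B$ is a $\mathcal{C}$-cofibration and $U \subset B$ is a $G$-equivariant (that is, $G$-invariant) open subspace, then the restriction $i: A \cap U \to U$ is a $\mathcal{C}$-cofibration, where $A\cap U := i^{-1}(U)$.
   Context: All spaces are compactly generated weak Hausdorff, and all maps of $G$-spaces are $G$-equivariant. The $\mathcal{C}$-model structure on $G$-spaces is the topological model structure cofibrantly generated by the generating cofibrations $G/H\times S^{n-1}\to G/H\times D^n$ ($n\ge 0$, $H\in\mathcal{C}$) and the generating acyclic cofibrations $G/H\times D^n\to G/H\times D^n\times [0,1]$ (inclusion at $0$; $n\ge 0$, $H\in\mathcal{C}$). Its fibrations (resp. weak equivalences) are the $G$-maps $p$ such that $p^H$ is a Serre fibration (resp. weak homotopy equivalence) for every $H\in\mathcal{C}$. Its cofibrations are called $\mathcal{C}$-cofibrations; equivalently, they are the retracts of relative $\mathcal{C}$-cell complexes (transfinite composites of pushouts of generating cofibrations). *)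

theory Defs
  imports "HOL-Analysis.Analysis" "HOL-Algebra.Left_Coset"
begin

section \<open>Compact Lie groups\<close>

text \<open>
  Lie groups are modelled on the library's Euclidean spaces \<open>Euclidean_space n\<close> (sequences of reals
  vanishing from index \<open>n\<close> on), so that every dimension including \<open>0\<close> is allowed.
  \<open>Ck_on n k S f\<close> is meant for \<open>S\<close> open in \<open>Euclidean_space n\<close>: all iterated partial derivatives of
  \<open>f\<close> up to order \<open>k\<close> exist and are continuous on \<open>S\<close>.
\<close>

primrec Ck_on :: "nat \<Rightarrow> nat \<Rightarrow> (nat \<Rightarrow> real) set \<Rightarrow> ((nat \<Rightarrow> real) \<Rightarrow> real) \<Rightarrow> bool" where
  "Ck_on n 0 S f \<longleftrightarrow> continuous_map (subtopology (Euclidean_space n) S) euclideanreal f"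
| "Ck_on n (Suc k) S f \<longleftrightarrow>
     continuous_map (subtopology (Euclidean_space n) S) euclideanreal f \<and>
     (\<forall>i<n. \<exists>g. (\<forall>x\<in>S. ((\<lambda>t. f (x(i := t))) has_real_derivative g x) (at (x i))) \<and> Ck_on n k S g)"

definition smooth_map :: "nat \<Rightarrow> nat \<Rightarrow> (nat \<Rightarrow> real) set \<Rightarrow> ((nat \<Rightarrow> real) \<Rightarrow> (nat \<Rightarrow> real)) \<Rightarrow> bool" where
  "smooth_map n m S f \<longleftrightarrow> (\<forall>j<m. \<forall>k. Ck_on n k S (\<lambda>x. f x j))"

definition chart :: "nat \<Rightarrow> 'x topology \<Rightarrow> 'x set \<Rightarrow> ('x \<Rightarrow> nat \<Rightarrow> real) \<Rightarrow> bool" where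
  "chart n M U \<phi> \<longleftrightarrow> openin M U \<and> openin (Euclidean_space n) (\<phi> ` U) \<and>
     homeomorphic_map (subtopology M U) (subtopology (Euclidean_space n) (\<phi> ` U)) \<phi>"

definition smooth_atlas :: "nat \<Rightarrow> 'x topology \<Rightarrow> ('x set \<times> ('x \<Rightarrow> nat \<Rightarrow> real)) set \<Rightarrow> bool" where
  "smooth_atlas n M \<A> \<longleftrightarrow>
     (\<forall>(U, \<phi>)\<in>\<A>. chart n M U \<phi>) \<and>
     (\<Union>(U, \<phi>)\<in>\<A>. U) = topspace M \<and>
     (\<forall>(U, \<phi>)\<in>\<A>. \<forall>(V, \<psi>)\<in>\<A>. smooth_map n n (\<phi> ` (U \<inter> V)) (\<psi> \<circ> inv_into U \<phi>))"

record 'g topgroup = "'g monoid" +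
  gtopology :: "'g topology"

text \<open>
  In the clause for the multiplication, a point \<open>z\<close> of \<open>Euclidean_space (n + n)\<close> is split into its
  first and its last \<open>n\<close> coordinates.
\<close>

definition Lie_group :: "('g, 'm) topgroup_scheme \<Rightarrow> bool" where
  "Lie_group G \<longleftrightarrow>
     group G \<and> topspace (gtopology G) = carrier G \<and>
     Hausdorff_space (gtopology G) \<and> second_countable (gtopology G) \<and>
     continuous_map (prod_topology (gtopology G) (gtopology G)) (gtopology G) (\<lambda>(x, y). x \<otimes>\<^bsub>G\<^esub> y) \<and>
     continuous_map (gtopology G) (gtopology G) (\<lambda>x. inv\<^bsub>G\<^esub> x) \<and>
     (\<exists>n \<A>. smooth_atlas n (gtopology G) \<A> \<and>
        (\<forall>(U, \<phi>)\<in>\<A>. \<forall>(V, \<psi>)\<in>\<A>. \<forall>(W, \<xi>)\<in>\<A>.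
           let x = (\<lambda>z. inv_into U \<phi> (\<lambda>i. if i < n then z i else 0));
               y = (\<lambda>z. inv_into V \<psi> (\<lambda>i. z (n + i)))
           in smooth_map (n + n) n
                {z \<in> topspace (Euclidean_space (n + n)).
                   (\<lambda>i. if i < n then z i else 0) \<in> \<phi> ` U \<and> (\<lambda>i. z (n + i)) \<in> \<psi> ` V \<and>
                   x z \<otimes>\<^bsub>G\<^esub> y z \<in> W}
                (\<lambda>z. \<xi> (x z \<otimes>\<^bsub>G\<^esub> y z))) \<and>
        (\<forall>(U, \<phi>)\<in>\<A>. \<forall>(V, \<psi>)\<in>\<A>.
           smooth_map n n (\<phi> ` {x \<in> U. inv\<^bsub>G\<^esub> x \<in> V}) (\<lambda>z. \<psi> (inv\<^bsub>G\<^esub> (inv_into U \<phi> z)))))"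

definition compact_Lie_group :: "('g, 'm) topgroup_scheme \<Rightarrow> bool" where
  "compact_Lie_group G \<longleftrightarrow> Lie_group G \<and> compact_space (gtopology G)"


section \<open>Compactly generated weak Hausdorff spaces\<close>

text \<open>
  Compact Hausdorff test spaces are taken on the type \<open>'x set set\<close>, which loses nothing. If
  \<open>f : K \<rightarrow> X\<close> has non-closed image, so has its restriction to the closure of a set of preimages, one
  for each point of the image; the closure of a subset of cardinality at most \<open>|X|\<close> of a Hausdorff
  space has at most \<open>2^(2^|X|)\<close> points. If \<open>X\<close> is weak Hausdorff, then images of test maps are compact
  Hausdorff subspaces of \<open>X\<close>, and it is enough to test closedness on these.
\<close>

definition test_map :: "'k topology \<Rightarrow> 'x topology \<Rightarrow> ('k \<Rightarrow> 'x) \<Rightarrow> bool" where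
  "test_map K X f \<longleftrightarrow> compact_space K \<and> Hausdorff_space K \<and> continuous_map K X f"

definition weak_Hausdorff :: "'x topology \<Rightarrow> bool" where
  "weak_Hausdorff X \<longleftrightarrow>
     (\<forall>(K :: 'x set set topology) f. test_map K X f \<longrightarrow> closedin X (f ` topspace K))"

definition compactly_generated :: "'x topology \<Rightarrow> bool" where
  "compactly_generated X \<longleftrightarrow>
     (\<forall>S \<subseteq> topspace X.
        (\<forall>(K :: 'x set set topology) f. test_map K X f \<longrightarrow> closedin K {k \<in> topspace K. f k \<in> S})
        \<longrightarrow> closedin X S)"


section \<open>\<open>G\<close>-spaces\<close>

record ('g, 'x) gspace =
  space_top :: "'x topology"
  act :: "'g \<Rightarrow> 'x \<Rightarrow> 'x"

abbreviation points :: "('g, 'x) gspace \<Rightarrow> 'x set" where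
  "points X \<equiv> topspace (space_top X)"

text \<open>
  As \<open>G\<close> is compact Hausdorff, the product topology on \<open>G \<times> X\<close> is already compactly generated.
\<close>

definition is_gspace :: "('g, 'm) topgroup_scheme \<Rightarrow> ('g, 'x) gspace \<Rightarrow> bool" where
  "is_gspace G X \<longleftrightarrow>
     compactly_generated (space_top X) \<and> weak_Hausdorff (space_top X) \<and>
     continuous_map (prod_topology (gtopology G) (space_top X)) (space_top X) (\<lambda>(g, x). act X g x) \<and>
     (\<forall>x\<in>points X. act X \<one>\<^bsub>G\<^esub> x = x) \<and>
     (\<forall>g\<in>carrier G. \<forall>h\<in>carrier G. \<forall>x\<in>points X. act X (g \<otimes>\<^bsub>G\<^esub> h) x = act X g (act X h x))"

definition gmap ::
  "('g, 'm) topgroup_scheme \<Rightarrow> ('g, 'x) gspace \<Rightarrow> ('g, 'y) gspace \<Rightarrow> ('x \<Rightarrow> 'y) \<Rightarrow> bool" where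
  "gmap G X Y f \<longleftrightarrow> continuous_map (space_top X) (space_top Y) f \<and>
     (\<forall>g\<in>carrier G. \<forall>x\<in>points X. f (act X g x) = act Y g (f x))"

definition invariant :: "('g, 'm) topgroup_scheme \<Rightarrow> ('g, 'x) gspace \<Rightarrow> 'x set \<Rightarrow> bool" where
  "invariant G X S \<longleftrightarrow> S \<subseteq> points X \<and> (\<forall>g\<in>carrier G. \<forall>x\<in>S. act X g x \<in> S)"

definition gsub :: "('g, 'x) gspace \<Rightarrow> 'x set \<Rightarrow> ('g, 'x) gspace" where
  "gsub X S = \<lparr>space_top = subtopology (space_top X) S, act = act X\<rparr>"


section \<open>Generating cofibrations\<close>

definition coset_space :: "('g, 'm) topgroup_scheme \<Rightarrow> 'g set \<Rightarrow> 'g set topology" where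
  "coset_space G H = topology (\<lambda>W. W \<subseteq> lcosets\<^bsub>G\<^esub> H \<and>
     openin (gtopology G) {g \<in> topspace (gtopology G). g <#\<^bsub>G\<^esub> H \<in> W})"

lemma openin_coset_space:
  "openin (coset_space G H) W \<longleftrightarrow> W \<subseteq> lcosets\<^bsub>G\<^esub> H \<and>
     openin (gtopology G) {g \<in> topspace (gtopology G). g <#\<^bsub>G\<^esub> H \<in> W}"
proof -
  let ?T = "gtopology G"
  let ?P = "\<lambda>W. {g \<in> topspace ?T. g <#\<^bsub>G\<^esub> H \<in> W}"
  have inter: "?P (S \<inter> T) = ?P S \<inter> ?P T" for S T
    by auto
  have union: "?P (\<Union>\<K>) = (\<Union>S\<in>\<K>. ?P S)" for \<K>
    by auto
  have "istopology (\<lambda>W. W \<subseteq> lcosets\<^bsub>G\<^esub> H \<and> openin ?T (?P W))"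
    unfolding istopology_def inter union by (auto intro!: openin_Int openin_Union)
  then show ?thesis
    unfolding coset_space_def by (simp add: topology_inverse')
qed

definition disc :: "nat \<Rightarrow> (nat \<Rightarrow> real) topology" where
  "disc n = subtopology (Euclidean_space n) {x. (\<Sum>i<n. (x i)\<^sup>2) \<le> 1}"

text \<open>The boundary sphere of \<open>disc n\<close>; for \<open>n = 0\<close> it is empty.\<close>

definition bdry_sphere :: "nat \<Rightarrow> (nat \<Rightarrow> real) topology" where
  "bdry_sphere n = subtopology (Euclidean_space n) {x. (\<Sum>i<n. (x i)\<^sup>2) = 1}"

definition orbit_times ::
  "('g, 'm) topgroup_scheme \<Rightarrow> 'g set \<Rightarrow> 'y topology \<Rightarrow> ('g, 'g set \<times> 'y) gspace" where
  "orbit_times G H Y =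
     \<lparr>space_top = prod_topology (coset_space G H) Y, act = (\<lambda>g (c, y). (g <#\<^bsub>G\<^esub> c, y))\<rparr>"


section \<open>Relative cell complexes and cofibrations\<close>

text \<open>
  A pushout square of \<open>G\<close>-spaces with maps \<open>f : K \<rightarrow> X\<close>, \<open>j : K \<rightarrow> L\<close>, \<open>h : X \<rightarrow> Y\<close>, \<open>\<Phi> : L \<rightarrow> Y\<close>:
  \<open>Y\<close> is the quotient space of the disjoint union of \<open>X\<close> and \<open>L\<close> by the equivalence relation
  generated by \<open>f a \<sim> j a\<close>. When \<open>j\<close> is a closed inclusion, as below, this space is weak
  Hausdorff and compactly generated if \<open>X\<close> and \<open>L\<close> are, so it is the pushout in that category too.
\<close>

definition glue :: "'k set \<Rightarrow> ('k \<Rightarrow> 'x) \<Rightarrow> ('k \<Rightarrow> 'l) \<Rightarrow> ('x + 'l) rel" where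
  "glue K f j = {(Inl (f a), Inr (j a)) |a. a \<in> K}"

definition pushout_square ::
  "('g, 'm) topgroup_scheme \<Rightarrow> ('g, 'k) gspace \<Rightarrow> ('g, 'x) gspace \<Rightarrow> ('g, 'l) gspace \<Rightarrow> ('g, 'y) gspace
   \<Rightarrow> ('k \<Rightarrow> 'x) \<Rightarrow> ('k \<Rightarrow> 'l) \<Rightarrow> ('x \<Rightarrow> 'y) \<Rightarrow> ('l \<Rightarrow> 'y) \<Rightarrow> bool" where
  "pushout_square G K X L Y f j h \<Phi> \<longleftrightarrow>
     gmap G K X f \<and> gmap G K L j \<and> gmap G X Y h \<and> gmap G L Y \<Phi> \<and>
     points Y = h ` points X \<union> \<Phi> ` points L \<and>
     (\<forall>u \<in> points X <+> points L. \<forall>v \<in> points X <+> points L.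
        case_sum h \<Phi> u = case_sum h \<Phi> v \<longleftrightarrow>
        (u, v) \<in> (glue (points K) f j \<union> (glue (points K) f j)\<inverse>)\<^sup>*) \<and>
     (\<forall>V \<subseteq> points Y. openin (space_top Y) V \<longleftrightarrow>
        openin (space_top X) {x \<in> points X. h x \<in> V} \<and> openin (space_top L) {l \<in> points L. \<Phi> l \<in> V})"

text \<open>
  \<open>h : X \<rightarrow> Y\<close> is a pushout of a generating cofibration \<open>G/H \<times> S\<^sup>n\<^sup>-\<^sup>1 \<rightarrow> G/H \<times> D\<^sup>n\<close> with \<open>H \<in> \<C>\<close>.
\<close>

definition cell_attachment ::
  "('g, 'm) topgroup_scheme \<Rightarrow> 'g set set \<Rightarrow> ('g, 'x) gspace \<Rightarrow> ('g, 'y) gspace \<Rightarrow> ('x \<Rightarrow> 'y) \<Rightarrow> bool" where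
  "cell_attachment G \<C> X Y h \<longleftrightarrow>
     (\<exists>H\<in>\<C>. \<exists>n f \<Phi>. pushout_square G
        (orbit_times G H (bdry_sphere n)) X (orbit_times G H (disc n)) Y f (\<lambda>a. a) h \<Phi>)"

text \<open>
  \<open>j : A \<rightarrow> Z\<close> is a transfinite composite of cell attachments. All maps in such a transfinite sequence
  are closed inclusions, and successive stages are distinct because an attachment adds the nonempty
  set \<open>G/H \<times> (D\<^sup>n - S\<^sup>n\<^sup>-\<^sup>1)\<close>. Hence the sequence, together with its composite, is recorded as the set
  \<open>\<F>\<close> of its stages, regarded as subspaces of \<open>Z\<close>: this set is well-ordered by inclusion, the least
  stage is a copy of \<open>A\<close>, the greatest stage is \<open>Z\<close>, a successor stage arises from its predecessor by
  a cell attachment, and a limit stage is the colimit (union with the final topology) of the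
  preceding stages.
\<close>

definition successor_stage :: "'z set set \<Rightarrow> 'z set \<Rightarrow> 'z set \<Rightarrow> bool" where
  "successor_stage \<F> D E \<longleftrightarrow> D \<in> \<F> \<and> E \<in> \<F> \<and> D \<subset> E \<and> (\<forall>D'\<in>\<F>. D' \<subset> E \<longrightarrow> D' \<subseteq> D)"

definition colimit_of_stages :: "'z topology \<Rightarrow> 'z set set \<Rightarrow> 'z set \<Rightarrow> bool" where
  "colimit_of_stages Z \<D> E \<longleftrightarrow> E = \<Union>\<D> \<and>
     (\<forall>V \<subseteq> E. openin (subtopology Z E) V \<longleftrightarrow> (\<forall>D\<in>\<D>. openin (subtopology Z D) (V \<inter> D)))"

definition relative_cell_complex ::
  "('g, 'm) topgroup_scheme \<Rightarrow> 'g set set \<Rightarrow> ('g, 'a) gspace \<Rightarrow> ('g, 'z) gspace \<Rightarrow> ('a \<Rightarrow> 'z) \<Rightarrow> bool" where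
  "relative_cell_complex G \<C> A Z j \<longleftrightarrow>
     is_gspace G A \<and> is_gspace G Z \<and> gmap G A Z j \<and>
     (\<exists>\<F>. (\<forall>E\<in>\<F>. invariant G Z E) \<and>
        (\<forall>\<S> \<subseteq> \<F>. \<S> \<noteq> {} \<longrightarrow> (\<exists>D\<in>\<S>. \<forall>E\<in>\<S>. D \<subseteq> E)) \<and>
        j ` points A \<in> \<F> \<and> (\<forall>E\<in>\<F>. j ` points A \<subseteq> E) \<and> embedding_map (space_top A) (space_top Z) j \<and>
        points Z \<in> \<F> \<and>
        (\<forall>E\<in>\<F>. E = j ` points A \<or>
           (\<exists>D. successor_stage \<F> D E \<and> cell_attachment G \<C> (gsub Z D) (gsub Z E) (\<lambda>x. x)) \<or>
           colimit_of_stages (space_top Z) {D \<in> \<F>. D \<subset> E} E))"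

text \<open>
  \<open>\<C>\<close>-cofibrations, as retracts (in the category of \<open>G\<close>-maps) of relative \<open>\<C>\<close>-cell complexes
  \<open>j : C \<rightarrow> Z\<close>. HOL has no quantification over types, so the type argument names the universe in which
  \<open>C\<close> and \<open>Z\<close> live. If \<open>i\<close> is a retract of any relative \<open>\<C>\<close>-cell complex, then it is one with
  \<open>C = A\<close> (push out along \<open>C \<rightarrow> A\<close>) and \<open>Z\<close> the subcomplex generated by \<open>A\<close> and the image of \<open>B\<close>; for
  compact Lie \<open>G\<close> this \<open>Z\<close> has at most as many points as \<open>B \<times> \<real>\<close>. So every \<open>'z\<close> at least as large as
  \<open>'b \<times> real\<close> gives the same notion.
\<close>

definition cofibration ::
  "'z itself \<Rightarrow> ('g, 'm) topgroup_scheme \<Rightarrow> 'g set set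
   \<Rightarrow> ('g, 'a) gspace \<Rightarrow> ('g, 'b) gspace \<Rightarrow> ('a \<Rightarrow> 'b) \<Rightarrow> bool" where
  "cofibration _ G \<C> A B i \<longleftrightarrow>
     is_gspace G A \<and> is_gspace G B \<and> gmap G A B i \<and>
     (\<exists>(C :: ('g, 'z) gspace) (Z :: ('g, 'z) gspace) j s r s' r'.
        relative_cell_complex G \<C> C Z j \<and>
        gmap G A C s \<and> gmap G C A r \<and> gmap G B Z s' \<and> gmap G Z B r' \<and>
        (\<forall>a\<in>points A. r (s a) = a) \<and> (\<forall>b\<in>points B. r' (s' b) = b) \<and>
        (\<forall>a\<in>points A. j (s a) = s' (i a)) \<and> (\<forall>c\<in>points C. i (r c) = r' (j c)))"

end

theory Submission
  imports Defs
begin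

text \<open>
  The restriction of a retract diagram to the preimages of an open invariant set is again a retract
  diagram, so it is enough to show that an open invariant subspace \<open>V\<close> of a relative cell complex \<open>Z\<close> is
  itself a relative cell complex, relative to the part of the base that lies in \<open>V\<close>. In this form all new
  stages are subsets of \<open>V\<close>, so the resulting complex lives in the same universe as \<open>Z\<close>.
  
  Intersecting the stages of \<open>Z\<close> with \<open>V\<close> yields a transfinite chain with the right limits. At a
  successor step, where \<open>E\<close> is \<open>D\<close> with one cell \<open>G/H \<times> D\<^sup>n\<close> attached, \<open>D \<inter> V \<subseteq> E \<inter> V\<close> is in general
  not a single attachment: the preimage of \<open>V\<close> in the cell is \<open>G/H \<times> W\<close> with \<open>W\<close> open in the disc, because
  \<open>V\<close> is invariant and the action on \<open>G/H\<close> is transitive. It has to be subdivided. Regard the disc as a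
  cube and let \<open>P\<^sub>k\<close> be the union of \<open>W \<inter> \<partial>\<close> and all closed faces of the dyadic grid of mesh \<open>2\<^sup>-\<^sup>k\<close>
  contained in \<open>W\<close>. Each \<open>P\<^sub>k\<close> arises from the previous one by attaching finitely many faces, each along
  its frontier, and each point of \<open>W\<close> is interior to some \<open>P\<^sub>k\<close>, so that \<open>W\<close> is their colimit
  (\<open>dyadic_exhaustion\<close>). Faces are boxes and thus homeomorphic to discs with their spheres
  (\<open>ball_cbox_homeomorphism\<close>). Multiplying with \<open>G/H\<close> and gluing gives a sequence of cell attachments from
  \<open>D \<inter> V\<close> to \<open>E \<inter> V\<close> (\<open>cellular_restriction\<close>).
  
  These sequences are then inserted into the chain of the stages \<open>E \<inter> V\<close>; that the outcome is again a
  well-ordered chain of attachments and colimits is \<open>cellular_composition\<close>. Finally, open subspaces of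
  compactly generated weak Hausdorff spaces are of the same kind (\<open>compactly_generated_open\<close>).
\<close>

section \<open>Chains of cell attachments\<close>

text \<open>
  This is the datum in the definition of a relative cell complex, with both ends of the chain free:
  a transfinite sequence of cell attachments from \<open>D\<close> to \<open>E\<close> inside a fixed ambient \<open>Z\<close>. Keeping \<open>Z\<close>
  fixed makes such chains composable without any change of space.
\<close>

definition filtration ::
  "('g, 'm) topgroup_scheme \<Rightarrow> 'g set set \<Rightarrow> ('g, 'z) gspace \<Rightarrow> 'z set set \<Rightarrow> 'z set \<Rightarrow> 'z set \<Rightarrow> bool" where
  "filtration G \<C> Z \<F> D E \<longleftrightarrow>
     (\<forall>T\<in>\<F>. invariant G Z T) \<and>
     (\<forall>\<S> \<subseteq> \<F>. \<S> \<noteq> {} \<longrightarrow> (\<exists>T\<in>\<S>. \<forall>T'\<in>\<S>. T \<subseteq> T')) \<and>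
     D \<in> \<F> \<and> E \<in> \<F> \<and> (\<forall>T\<in>\<F>. D \<subseteq> T \<and> T \<subseteq> E) \<and>
     (\<forall>T\<in>\<F>. T = D \<or>
        (\<exists>T'. successor_stage \<F> T' T \<and> cell_attachment G \<C> (gsub Z T') (gsub Z T) (\<lambda>x. x)) \<or>
        colimit_of_stages (space_top Z) {T' \<in> \<F>. T' \<subset> T} T)"

definition cellular ::
  "('g, 'm) topgroup_scheme \<Rightarrow> 'g set set \<Rightarrow> ('g, 'z) gspace \<Rightarrow> 'z set \<Rightarrow> 'z set \<Rightarrow> bool" where
  "cellular G \<C> Z D E \<longleftrightarrow> (\<exists>\<F>. filtration G \<C> Z \<F> D E)"

lemma filtrationD:
  assumes "filtration G \<C> Z \<F> D E"
  shows "T \<in> \<F> \<Longrightarrow> invariant G Z T"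
    and "\<S> \<subseteq> \<F> \<Longrightarrow> \<S> \<noteq> {} \<Longrightarrow> \<exists>T\<in>\<S>. \<forall>T'\<in>\<S>. T \<subseteq> T'"
    and "D \<in> \<F>" "E \<in> \<F>"
    and "T \<in> \<F> \<Longrightarrow> D \<subseteq> T" "T \<in> \<F> \<Longrightarrow> T \<subseteq> E"
    and "T \<in> \<F> \<Longrightarrow> T = D \<or>
        (\<exists>T'. successor_stage \<F> T' T \<and> cell_attachment G \<C> (gsub Z T') (gsub Z T) (\<lambda>x. x)) \<or>
        colimit_of_stages (space_top Z) {T' \<in> \<F>. T' \<subset> T} T"
  using assms unfolding filtration_def by simp_all

lemma cellular_refl: "invariant G Z D \<Longrightarrow> cellular G \<C> Z D D"
  unfolding cellular_def filtration_def by (rule exI[of _ "{D}"]) auto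

lemma cellular_invariant:
  "cellular G \<C> Z D E \<Longrightarrow> invariant G Z D \<and> invariant G Z E \<and> D \<subseteq> E"
  unfolding cellular_def by (auto dest: filtrationD(1,3,4,5))

lemma cellular_cell:
  assumes "invariant G Z D" "invariant G Z E" "D \<subset> E"
    and "cell_attachment G \<C> (gsub Z D) (gsub Z E) (\<lambda>x. x)"
  shows "cellular G \<C> Z D E"
  unfolding cellular_def filtration_def
proof (intro exI[of _ "{D, E}"] conjI)
  show "\<forall>\<S>\<subseteq>{D, E}. \<S> \<noteq> {} \<longrightarrow> (\<exists>T\<in>\<S>. \<forall>T'\<in>\<S>. T \<subseteq> T')"
  proof (intro allI impI)
    fix \<S> assume "\<S> \<subseteq> {D, E}" "\<S> \<noteq> {}"
    with assms(3) show "\<exists>T\<in>\<S>. \<forall>T'\<in>\<S>. T \<subseteq> T'"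
      by (cases "D \<in> \<S>") blast+
  qed
  have "successor_stage {D, E} D E"
    using assms(3) unfolding successor_stage_def by blast
  then show "\<forall>T\<in>{D, E}. T = D \<or>
        (\<exists>T'. successor_stage {D, E} T' T \<and> cell_attachment G \<C> (gsub Z T') (gsub Z T) (\<lambda>x. x)) \<or>
        colimit_of_stages (space_top Z) {T' \<in> {D, E}. T' \<subset> T} T"
    using assms(4) by blast
qed (use assms in auto)

lemma openin_subtopology_trans:
  assumes "openin (subtopology X E) V" "D \<subseteq> E"
  shows "openin (subtopology X D) (V \<inter> D)"
  using assms unfolding openin_subtopology by blast

text \<open>
  Stages that are merely inserted below \<open>E\<close> cannot spoil a colimit: openness in \<open>E\<close> implies openness
  in every subset of \<open>E\<close>, and the old stages still suffice for the converse.
\<close>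

lemma colimit_of_stages_mono:
  assumes "colimit_of_stages Z \<D> E" "\<D> \<subseteq> \<D>'" "\<And>D. D \<in> \<D>' \<Longrightarrow> D \<subseteq> E"
  shows "colimit_of_stages Z \<D>' E"
proof -
  have E: "E = \<Union>\<D>"
    and o: "\<And>V. V \<subseteq> E \<Longrightarrow>
      openin (subtopology Z E) V \<longleftrightarrow> (\<forall>D\<in>\<D>. openin (subtopology Z D) (V \<inter> D))"
    using assms(1) unfolding colimit_of_stages_def by blast+
  have "openin (subtopology Z E) V \<longleftrightarrow> (\<forall>D\<in>\<D>'. openin (subtopology Z D) (V \<inter> D))"
    if "V \<subseteq> E" for V
    using o[OF that] openin_subtopology_trans[of Z E V] assms(2,3) by blast
  moreover have "E = \<Union>\<D>'"
    using E assms(2,3) by blast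
  ultimately show ?thesis
    unfolding colimit_of_stages_def by blast
qed

text \<open>
  Transfinite composites of cellular inclusions are cellular. For each successor step \<open>D \<subset> S\<close> of the
  given chain \<open>\<S>\<close> a filtration \<open>K D S\<close> from \<open>D\<close> to \<open>S\<close> is chosen, and all of these are inserted into \<open>\<S>\<close>.
  Every new stage is comparable with every member of \<open>\<S>\<close>, so a new stage lying between \<open>D\<close> and \<open>S\<close> belongs
  to \<open>K D S\<close>; hence minima and immediate predecessors can be computed either in \<open>\<S>\<close> or in a single
  \<open>K D S\<close>.
\<close>

lemma cellular_composition:
  assumes wo: "\<And>\<T>. \<T> \<subseteq> \<S> \<Longrightarrow> \<T> \<noteq> {} \<Longrightarrow> \<exists>T\<in>\<T>. \<forall>T'\<in>\<T>. T \<subseteq> T'"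
    and D0: "D0 \<in> \<S>" "\<And>S. S \<in> \<S> \<Longrightarrow> D0 \<subseteq> S"
    and E0: "E0 \<in> \<S>" "\<And>S. S \<in> \<S> \<Longrightarrow> S \<subseteq> E0"
    and inv: "\<And>S. S \<in> \<S> \<Longrightarrow> invariant G Z S"
    and step: "\<And>S. S \<in> \<S> \<Longrightarrow> S = D0 \<or> (\<exists>D. successor_stage \<S> D S \<and> cellular G \<C> Z D S) \<or>
      colimit_of_stages (space_top Z) {D \<in> \<S>. D \<subset> S} S"
  shows "cellular G \<C> Z D0 E0"
proof -
  define succ where "succ D S \<longleftrightarrow> successor_stage \<S> D S \<and> cellular G \<C> Z D S" for D S
  define K where "K D S = (SOME \<F>. filtration G \<C> Z \<F> D S)" for D S
  have K: "filtration G \<C> Z (K D S) D S" if "succ D S" for D S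
    using that unfolding succ_def cellular_def K_def by (auto intro: someI_ex)
  note K_inv = filtrationD(1)[OF K] and K_wo = filtrationD(2)[OF K] and K_ends = filtrationD(3,4)[OF K]
    and K_between = filtrationD(5,6)[OF K] and K_step = filtrationD(7)[OF K]
  have succD: "D \<in> \<S>" "S \<in> \<S>" "D \<subset> S" "S' \<in> \<S> \<Longrightarrow> S' \<subset> S \<Longrightarrow> S' \<subseteq> D"
    if "succ D S" for D S S'
    using that unfolding succ_def successor_stage_def by blast+
  have total: "S \<subseteq> S' \<or> S' \<subseteq> S" if "S \<in> \<S>" "S' \<in> \<S>" for S S'
    using wo[of "{S, S'}"] that by blast
  define \<F> where "\<F> = \<S> \<union> \<Union>{K D S |D S. succ D S}"
  have F_cases: "T \<in> \<S> \<or> (\<exists>D S. succ D S \<and> T \<in> K D S)" if "T \<in> \<F>" for T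
    using that unfolding \<F>_def by blast
  have comparable: "T \<subseteq> S \<or> S \<subseteq> T" if T: "T \<in> \<F>" and S: "S \<in> \<S>" for T S
    using F_cases[OF T]
  proof
    assume "\<exists>D S. succ D S \<and> T \<in> K D S"
    then obtain D S' where s: "succ D S'" and "T \<in> K D S'" by blast
    with K_between have DT: "D \<subseteq> T" "T \<subseteq> S'" by blast+
    show ?thesis
    proof (cases "S' \<subseteq> S")
      case False
      then have "S \<subset> S'" using total succD(2)[OF s] S by blast
      then show ?thesis using succD(4)[OF s S] DT by blast
    qed (use DT in blast)
  qed (use total S in blast)
  \<comment> \<open>The inserted chains do not interleave.\<close>
  have local: "T \<in> K D S" if s: "succ D S" and T: "T \<in> \<F>" "D \<subseteq> T" "T \<subseteq> S" for T D S
    using F_cases[OF T(1)]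
  proof
    assume "T \<in> \<S>"
    then have "T = S \<or> T = D" using succD(4)[OF s, of T] T by blast
    then show ?thesis using K_ends[OF s] by blast
  next
    assume "\<exists>D S. succ D S \<and> T \<in> K D S"
    then obtain D' S' where s': "succ D' S'" and TK: "T \<in> K D' S'" by blast
    have b: "D' \<subseteq> T" "T \<subseteq> S'" using K_between[OF s' TK] .
    consider "S = S'" | "S \<subset> S'" | "S' \<subset> S"
      using total[OF succD(2)[OF s] succD(2)[OF s']] by blast
    then show ?thesis
    proof cases
      case 1
      then have "D = D'"
        using succD[OF s] succD[OF s'] by (metis subset_antisym)
      with 1 TK show ?thesis by blast
    next
      case 2
      then have "S \<subseteq> D'" using succD(4)[OF s' succD(2)[OF s]] by blast
      then have "T = S" using b T by blast
      then show ?thesis using K_ends[OF s] by blast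
    next
      case 3
      then have "S' \<subseteq> D" using succD(4)[OF s succD(2)[OF s']] by blast
      then have "T = D" using b T by blast
      then show ?thesis using K_ends[OF s] by blast
    qed
  qed
  have above_colimit: "S \<subseteq> T"
    if "colimit_of_stages (space_top Z) {D \<in> \<S>. D \<subset> S} S"
      and "\<And>D. D \<in> \<S> \<Longrightarrow> D \<subset> S \<Longrightarrow> D \<subseteq> T" for S T
    using that unfolding colimit_of_stages_def by blast
  have step': "S = D0 \<or> (\<exists>D. succ D S) \<or>
      colimit_of_stages (space_top Z) {D \<in> \<S>. D \<subset> S} S" if "S \<in> \<S>" for S
    using step[OF that] unfolding succ_def .
  have bounds: "D0 \<subseteq> T \<and> T \<subseteq> E0" if "T \<in> \<F>" for T
    using F_cases[OF that]
  proof
    assume "\<exists>D S. succ D S \<and> T \<in> K D S"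
    then obtain D S where "succ D S" "T \<in> K D S" by blast
    then show ?thesis
      using K_between[of D S T] D0(2)[of D] E0(2)[of S] succD(1,2)[of D S] by blast
  qed (use D0 E0 in blast)
  have "filtration G \<C> Z \<F> D0 E0"
    unfolding filtration_def
  proof (intro conjI)
    show "\<forall>T\<in>\<F>. invariant G Z T"
      using F_cases inv K_inv by metis
    show "D0 \<in> \<F>" "E0 \<in> \<F>"
      using D0 E0 unfolding \<F>_def by blast+
    show "\<forall>T\<in>\<F>. D0 \<subseteq> T \<and> T \<subseteq> E0"
      using bounds by blast
    show "\<forall>\<T> \<subseteq> \<F>. \<T> \<noteq> {} \<longrightarrow> (\<exists>T\<in>\<T>. \<forall>T'\<in>\<T>. T \<subseteq> T')"
    proof (intro allI impI)
      fix \<T> assume \<T>: "\<T> \<subseteq> \<F>" "\<T> \<noteq> {}"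
      have "\<exists>S\<in>{S \<in> \<S>. \<exists>T\<in>\<T>. T \<subseteq> S}. \<forall>S'\<in>{S \<in> \<S>. \<exists>T\<in>\<T>. T \<subseteq> S}. S \<subseteq> S'"
        using \<T> bounds E0(1) by (intro wo) blast+
      then obtain S T0 where S: "S \<in> \<S>" and T0: "T0 \<in> \<T>" "T0 \<subseteq> S"
        and least: "\<And>S' T. S' \<in> \<S> \<Longrightarrow> T \<in> \<T> \<Longrightarrow> T \<subseteq> S' \<Longrightarrow> S \<subseteq> S'"
        by blast
      have lower: "D \<subseteq> T" if "D \<in> \<S>" "D \<subset> S" "T \<in> \<T>" for D T
        using least[OF that(1,3)] comparable[of T D] that \<T> by blast
      \<comment> \<open>The least stage of \<open>\<T>\<close> lies in the last step below \<open>S\<close>, since no member of \<open>\<T>\<close> fits into an earlier one.\<close>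
      consider "S = D0" | D where "succ D S" | "colimit_of_stages (space_top Z) {D \<in> \<S>. D \<subset> S} S"
        using step'[OF S] by blast
      then show "\<exists>T\<in>\<T>. \<forall>T'\<in>\<T>. T \<subseteq> T'"
      proof cases
        case 1
        have "T0 \<subseteq> T" if "T \<in> \<T>" for T
          using T0(2) 1 bounds[of T] that \<T>(1) by blast
        then show ?thesis using T0(1) by blast
      next
        case 2
        have inK: "T \<in> K D S" if "T \<in> \<T>" "T \<subseteq> S" for T
        proof (rule local[OF 2 _ _ that(2)])
          show "T \<in> \<F>" using that(1) \<T>(1) by blast
          show "D \<subseteq> T" using lower[OF succD(1,3)[OF 2] that(1)] .
        qed
        have "{T \<in> \<T>. T \<subseteq> S} \<subseteq> K D S" "{T \<in> \<T>. T \<subseteq> S} \<noteq> {}"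
          using inK T0 by auto
        from K_wo[OF 2 this]
        obtain L where L: "L \<in> \<T>" "L \<subseteq> S" "\<And>T. T \<in> \<T> \<Longrightarrow> T \<subseteq> S \<Longrightarrow> L \<subseteq> T"
          by auto
        have "L \<subseteq> T" if "T \<in> \<T>" for T
          using comparable[of T S] S \<T>(1) L(2,3) that by blast
        then show ?thesis using L(1) by blast
      next
        case 3
        have "S \<subseteq> T" if "T \<in> \<T>" for T
          using above_colimit[OF 3, of T] lower[of _ T] that by simp
        then have "\<forall>T'\<in>\<T>. T0 \<subseteq> T'" using T0(2) by blast
        then show ?thesis using T0(1) by blast
      qed
    qed
    show "\<forall>T\<in>\<F>. T = D0 \<or>
        (\<exists>T'. successor_stage \<F> T' T \<and> cell_attachment G \<C> (gsub Z T') (gsub Z T) (\<lambda>x. x)) \<or>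
        colimit_of_stages (space_top Z) {T' \<in> \<F>. T' \<subset> T} T"
    proof
      fix T assume T: "T \<in> \<F>"
      consider "T = D0" | "colimit_of_stages (space_top Z) {D \<in> \<S>. D \<subset> T} T"
        | D S where "succ D S" "T \<in> K D S" "T \<noteq> D"
      proof (cases "T \<in> \<S>")
        case True
        then show thesis using step'[OF True] that K_ends succD(3) by blast
      next
        case False
        then obtain D S where "succ D S" "T \<in> K D S" using F_cases[OF T] by blast
        then show thesis using that(3)[of D S] succD(1) False by blast
      qed
      then show "T = D0 \<or>
        (\<exists>T'. successor_stage \<F> T' T \<and> cell_attachment G \<C> (gsub Z T') (gsub Z T) (\<lambda>x. x)) \<or>
        colimit_of_stages (space_top Z) {T' \<in> \<F>. T' \<subset> T} T"
      proof cases
        case 2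
        then have "colimit_of_stages (space_top Z) {T' \<in> \<F>. T' \<subset> T} T"
          by (rule colimit_of_stages_mono) (auto simp: \<F>_def)
        then show ?thesis by blast
      next
        case 3
        have sub: "K D S \<subseteq> \<F>" using 3(1) unfolding \<F>_def by blast
        from K_step[OF 3(1,2)] 3(3) consider
          T' where "successor_stage (K D S) T' T" "cell_attachment G \<C> (gsub Z T') (gsub Z T) (\<lambda>x. x)"
          | "colimit_of_stages (space_top Z) {T' \<in> K D S. T' \<subset> T} T" by blast
        then show ?thesis
        proof cases
          case 1
          from 1(1) have T': "T' \<in> K D S" "T' \<subset> T" "\<And>T''. T'' \<in> K D S \<Longrightarrow> T'' \<subset> T \<Longrightarrow> T'' \<subseteq> T'"
            unfolding successor_stage_def by auto
          have "T'' \<subseteq> T'" if T'': "T'' \<in> \<F>" "T'' \<subset> T" for T''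
          proof (cases "T'' \<subseteq> D")
            case True
            then show ?thesis using K_between(1)[OF 3(1) T'(1)] by blast
          next
            case False
            then have "D \<subseteq> T''" using comparable[OF T''(1) succD(1)[OF 3(1)]] by blast
            moreover have "T'' \<subseteq> S" using T''(2) K_between(2)[OF 3(1,2)] by blast
            ultimately have "T'' \<in> K D S"
              using local[OF 3(1) T''(1)] by blast
            then show ?thesis using T'(3) T''(2) by blast
          qed
          then have "successor_stage \<F> T' T"
            using T'(1,2) T sub unfolding successor_stage_def by auto
          then show ?thesis using 1(2) by blast
        next
          case 2
          then have "colimit_of_stages (space_top Z) {T' \<in> \<F>. T' \<subset> T} T"
            by (rule colimit_of_stages_mono) (use sub in auto)
          then show ?thesis by blast
        qed
      qed blast
    qed
  qed
  then show ?thesis unfolding cellular_def by blast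
qed

lemma cellular_trans:
  assumes "cellular G \<C> Z D T" "cellular G \<C> Z T E"
  shows "cellular G \<C> Z D E"
proof (rule cellular_composition[of "{D, T, E}"])
  from assms[THEN cellular_invariant]
  have sub: "D \<subseteq> T" "T \<subseteq> E" and inv: "invariant G Z D" "invariant G Z T" "invariant G Z E"
    by simp_all
  show "\<exists>L\<in>\<T>. \<forall>T'\<in>\<T>. L \<subseteq> T'" if \<T>: "\<T> \<subseteq> {D, T, E}" "\<T> \<noteq> {}" for \<T>
  proof -
    consider "D \<in> \<T>" | "D \<notin> \<T>" "T \<in> \<T>" | "\<T> = {E}"
      using \<T> by blast
    then show ?thesis
    proof cases
      case 1
      have "\<forall>T'\<in>\<T>. D \<subseteq> T'" using \<T>(1) sub by auto
      with 1 show ?thesis by metis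
    next
      case 2
      have "\<forall>T'\<in>\<T>. T \<subseteq> T'" using \<T>(1) sub 2(1) by auto
      with 2(2) show ?thesis by metis
    qed simp
  qed
  show "invariant G Z S" "D \<subseteq> S" "S \<subseteq> E" if "S \<in> {D, T, E}" for S
    using that sub inv by auto
  show "S = D \<or> (\<exists>D'. successor_stage {D, T, E} D' S \<and> cellular G \<C> Z D' S) \<or>
      colimit_of_stages (space_top Z) {D' \<in> {D, T, E}. D' \<subset> S} S" if S: "S \<in> {D, T, E}" for S
  proof -
    consider "S = D" | "S = T" "T \<noteq> D" | "S = E" "E \<noteq> T" "T \<noteq> D" | "S = E" "T = D" "E \<noteq> T"
      using S by blast
    then show ?thesis
    proof cases
      case 2
      then have "successor_stage {D, T, E} D S \<and> cellular G \<C> Z D S"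
        using sub assms(1) unfolding successor_stage_def by auto
      then show ?thesis by (rule disjI2[OF disjI1[OF exI]])
    next
      case 3
      then have "successor_stage {D, T, E} T S \<and> cellular G \<C> Z T S"
        using sub assms(2) unfolding successor_stage_def by auto
      then show ?thesis by (rule disjI2[OF disjI1[OF exI]])
    next
      case 4
      then have "successor_stage {D, T, E} T S \<and> cellular G \<C> Z T S"
        using sub assms(2) unfolding successor_stage_def by auto
      then show ?thesis by (rule disjI2[OF disjI1[OF exI]])
    qed simp
  qed
qed simp_all

text \<open>
  The steps of the sequence may be equalities, which is why the composition is taken over its range:
  a stage is assigned to the first index at which it occurs, and if \<open>E\<close> is itself attained then it is a
  successor or the first stage rather than a limit.
\<close>

lemma cellular_sequence:
  fixes Y :: "nat \<Rightarrow> 'z set"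
  assumes step: "\<And>k. cellular G \<C> Z (Y k) (Y (Suc k))"
    and colim: "colimit_of_stages (space_top Z) (range Y) E"
  shows "cellular G \<C> Z (Y 0) E"
proof (rule cellular_composition[of "insert E (range Y)"])
  have E: "E = \<Union>(range Y)"
    using colim unfolding colimit_of_stages_def by blast
  have mono: "Y k \<subseteq> Y l" if "k \<le> l" for k l
    using lift_Suc_mono_le[of Y, OF _ that] cellular_invariant[OF step] by simp
  have Yinv: "invariant G Z (Y k)" for k
    using cellular_invariant[OF step] by blast
  then have "invariant G Z E"
    unfolding E invariant_def by blast
  then show "invariant G Z S" if "S \<in> insert E (range Y)" for S
    using that Yinv by auto
  show "Y 0 \<in> insert E (range Y)" "E \<in> insert E (range Y)" by auto
  show "Y 0 \<subseteq> S" if "S \<in> insert E (range Y)" for S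
    using that mono[of 0] E by auto
  show "S \<subseteq> E" if "S \<in> insert E (range Y)" for S
    using that E by auto
  show "\<exists>T\<in>\<T>. \<forall>T'\<in>\<T>. T \<subseteq> T'" if \<T>: "\<T> \<subseteq> insert E (range Y)" "\<T> \<noteq> {}" for \<T>
  proof (cases "\<exists>k. Y k \<in> \<T>")
    case True
    define k where "k = (LEAST k. Y k \<in> \<T>)"
    have "Y k \<in> \<T>" unfolding k_def using True by (rule LeastI_ex)
    moreover have "Y k \<subseteq> T" if "T \<in> \<T>" for T
    proof -
      consider "T = E" | l where "T = Y l" using \<T> \<open>T \<in> \<T>\<close> by blast
      then show ?thesis
      proof cases
        case (2 l)
        then have "k \<le> l" unfolding k_def using \<open>T \<in> \<T>\<close> by (auto intro: Least_le)
        then show ?thesis using 2 mono by simp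
      qed (use E in auto)
    qed
    ultimately show ?thesis by blast
  qed (use \<T> in blast)
  show "S = Y 0 \<or> (\<exists>D. successor_stage (insert E (range Y)) D S \<and> cellular G \<C> Z D S) \<or>
      colimit_of_stages (space_top Z) {D \<in> insert E (range Y). D \<subset> S} S"
    if S: "S \<in> insert E (range Y)" for S
  proof (cases "\<exists>k. S = Y k")
    case True
    define k where "k = (LEAST k. S = Y k)"
    have k: "S = Y k" unfolding k_def using True by (rule LeastI_ex)
    show ?thesis
    proof (cases k)
      case (Suc l)
      then have "S \<noteq> Y l"
        unfolding k_def using not_less_Least[of l "\<lambda>k. S = Y k"] by simp
      then have sub: "Y l \<subset> S" using mono[of l k] k Suc by auto
      have "D \<subseteq> Y l" if D: "D \<in> insert E (range Y)" "D \<subset> S" for D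
      proof -
        have "D \<noteq> E" using D(2) k E by blast
        then obtain m where m: "D = Y m" using D(1) by blast
        then have "\<not> k \<le> m" using mono[of k m] D(2) k by blast
        then show ?thesis using m mono[of m l] Suc by auto
      qed
      then have "successor_stage (insert E (range Y)) (Y l) S"
        using sub S unfolding successor_stage_def by auto
      then show ?thesis using step[of l] k Suc by auto
    qed (use k in blast)
  next
    case False
    then have "S = E" using S by blast
    moreover have "{D \<in> insert E (range Y). D \<subset> E} = range Y"
      using False \<open>S = E\<close> E by blast
    ultimately show ?thesis using colim by simp
  qed
qed

section \<open>Attaching orbit cells of arbitrary shape\<close>

text \<open>
  \<open>E\<close> is the pushout of \<open>D\<close> along \<open>G/H \<times> L \<rightarrow> G/H \<times> K\<close> with characteristic map \<open>\<Psi>\<close>, spelled out pointwise: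
  \<open>\<Psi>\<close> adds the points over \<open>K - L\<close> freely, and \<open>E\<close> has the final topology. The shape \<open>(K, L)\<close> is arbitrary
  because cells will be replaced by cubes and cubes by boxes; only at the two ends is it a disc with
  its sphere. One implication in the topology clause is enough, the other being continuity.
\<close>

definition attaches ::
  "('g, 'm) topgroup_scheme \<Rightarrow> 'g set \<Rightarrow> ('g, 'z) gspace \<Rightarrow> 'z set \<Rightarrow> 'z set
   \<Rightarrow> 'y::topological_space set \<Rightarrow> 'y set \<Rightarrow> ('g set \<times> 'y \<Rightarrow> 'z) \<Rightarrow> bool" where
  "attaches G H Z D E K L \<Psi> \<longleftrightarrow>
     L \<subseteq> K \<and> E = D \<union> \<Psi> ` ((lcosets\<^bsub>G\<^esub> H) \<times> K) \<and> \<Psi> ` ((lcosets\<^bsub>G\<^esub> H) \<times> L) \<subseteq> D \<and>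
     inj_on \<Psi> ((lcosets\<^bsub>G\<^esub> H) \<times> (K - L)) \<and> \<Psi> ` ((lcosets\<^bsub>G\<^esub> H) \<times> (K - L)) \<inter> D = {} \<and>
     continuous_map (prod_topology (coset_space G H) (top_of_set K)) (space_top Z) \<Psi> \<and>
     (\<forall>g\<in>carrier G. \<forall>c\<in>lcosets\<^bsub>G\<^esub> H. \<forall>y\<in>K. \<Psi> (g <#\<^bsub>G\<^esub> c, y) = act Z g (\<Psi> (c, y))) \<and>
     (\<forall>V \<subseteq> E. openin (subtopology (space_top Z) D) (V \<inter> D) \<longrightarrow>
        openin (prod_topology (coset_space G H) (top_of_set K)) {p \<in> (lcosets\<^bsub>G\<^esub> H) \<times> K. \<Psi> p \<in> V} \<longrightarrow>
        openin (subtopology (space_top Z) E) V)"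

lemma attachesD:
  assumes "attaches G H Z D E K L \<Psi>"
  shows "L \<subseteq> K" "E = D \<union> \<Psi> ` ((lcosets\<^bsub>G\<^esub> H) \<times> K)"
    and "c \<in> lcosets\<^bsub>G\<^esub> H \<Longrightarrow> y \<in> L \<Longrightarrow> \<Psi> (c, y) \<in> D"
    and "inj_on \<Psi> ((lcosets\<^bsub>G\<^esub> H) \<times> (K - L))"
    and "c \<in> lcosets\<^bsub>G\<^esub> H \<Longrightarrow> y \<in> K \<Longrightarrow> y \<notin> L \<Longrightarrow> \<Psi> (c, y) \<notin> D"
    and "continuous_map (prod_topology (coset_space G H) (top_of_set K)) (space_top Z) \<Psi>"
    and "g \<in> carrier G \<Longrightarrow> c \<in> lcosets\<^bsub>G\<^esub> H \<Longrightarrow> y \<in> K \<Longrightarrow> \<Psi> (g <#\<^bsub>G\<^esub> c, y) = act Z g (\<Psi> (c, y))"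
    and "V \<subseteq> E \<Longrightarrow> openin (subtopology (space_top Z) D) (V \<inter> D) \<Longrightarrow>
      openin (prod_topology (coset_space G H) (top_of_set K)) {p \<in> (lcosets\<^bsub>G\<^esub> H) \<times> K. \<Psi> p \<in> V} \<Longrightarrow>
      openin (subtopology (space_top Z) E) V"
proof -
  note a = assms[unfolded attaches_def]
  show "L \<subseteq> K" "E = D \<union> \<Psi> ` ((lcosets\<^bsub>G\<^esub> H) \<times> K)"
    "inj_on \<Psi> ((lcosets\<^bsub>G\<^esub> H) \<times> (K - L))"
    "continuous_map (prod_topology (coset_space G H) (top_of_set K)) (space_top Z) \<Psi>"
    "g \<in> carrier G \<Longrightarrow> c \<in> lcosets\<^bsub>G\<^esub> H \<Longrightarrow> y \<in> K \<Longrightarrow> \<Psi> (g <#\<^bsub>G\<^esub> c, y) = act Z g (\<Psi> (c, y))"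
    using a by simp_all
  show "V \<subseteq> E \<Longrightarrow> openin (subtopology (space_top Z) D) (V \<inter> D) \<Longrightarrow>
      openin (prod_topology (coset_space G H) (top_of_set K)) {p \<in> (lcosets\<^bsub>G\<^esub> H) \<times> K. \<Psi> p \<in> V} \<Longrightarrow>
      openin (subtopology (space_top Z) E) V"
    using a by (elim conjE) (simp only:)
  have 1: "\<Psi> ` ((lcosets\<^bsub>G\<^esub> H) \<times> L) \<subseteq> D" and 2: "\<Psi> ` ((lcosets\<^bsub>G\<^esub> H) \<times> (K - L)) \<inter> D = {}"
    using a by simp_all
  show "c \<in> lcosets\<^bsub>G\<^esub> H \<Longrightarrow> y \<in> L \<Longrightarrow> \<Psi> (c, y) \<in> D"
    using 1 by blast
  show "c \<in> lcosets\<^bsub>G\<^esub> H \<Longrightarrow> y \<in> K \<Longrightarrow> y \<notin> L \<Longrightarrow> \<Psi> (c, y) \<notin> D"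
    using 2 by blast
qed

definition ball_set :: "nat \<Rightarrow> (nat \<Rightarrow> real) set" where
  "ball_set n = {x. (\<forall>i\<ge>n. x i = 0) \<and> (\<Sum>i<n. (x i)\<^sup>2) \<le> 1}"

definition sphere_set :: "nat \<Rightarrow> (nat \<Rightarrow> real) set" where
  "sphere_set n = {x. (\<forall>i\<ge>n. x i = 0) \<and> (\<Sum>i<n. (x i)\<^sup>2) = 1}"

lemma Euclidean_space_eq: "Euclidean_space n = top_of_set {x. \<forall>i\<ge>n. x i = 0}"
  by (simp add: Euclidean_space_def euclidean_product_topology)

lemma disc_eq: "disc n = top_of_set (ball_set n)"
  unfolding disc_def ball_set_def Euclidean_space_eq subtopology_subtopology
  by (rule arg_cong[where f="subtopology euclidean"]) auto

lemma bdry_sphere_eq: "bdry_sphere n = top_of_set (sphere_set n)"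
  unfolding bdry_sphere_def sphere_set_def Euclidean_space_eq subtopology_subtopology
  by (rule arg_cong[where f="subtopology euclidean"]) auto

lemma sphere_subset_ball: "sphere_set n \<subseteq> ball_set n"
  unfolding sphere_set_def ball_set_def by auto

lemma topspace_coset_space:
  assumes "topspace (gtopology G) = carrier G"
  shows "topspace (coset_space G H) = lcosets\<^bsub>G\<^esub> H"
proof -
  have "{g \<in> topspace (gtopology G). g <#\<^bsub>G\<^esub> H \<in> lcosets\<^bsub>G\<^esub> H} = topspace (gtopology G)"
    using assms unfolding LCOSETS_def by auto
  then have "openin (coset_space G H) (lcosets\<^bsub>G\<^esub> H)"
    unfolding openin_coset_space by simp
  moreover have "openin (coset_space G H) (topspace (coset_space G H))"
    by simp
  ultimately show ?thesis
    unfolding openin_coset_space[of G H "topspace (coset_space G H)"]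
    using openin_subset by blast
qed

lemma points_gsub: "S \<subseteq> points X \<Longrightarrow> points (gsub X S) = S"
  unfolding gsub_def by auto

text \<open>
  A point of the cell outside the attaching part is identified with nothing else, so the equivalence
  relation in a pushout square says exactly that the open cell is added injectively and disjointly.
\<close>

lemma glue_related_outside:
  assumes "(Inr l, v) \<in> (glue P f j \<union> (glue P f j)\<inverse>)\<^sup>*" "l \<notin> j ` P"
  shows "v = Inr l"
  using assms(1)
proof (induction rule: rtrancl_induct)
  case (step y z)
  then show ?case using assms(2) unfolding glue_def by auto
qed simp

lemma cell_attachment_imp_attaches:
  assumes G: "topspace (gtopology G) = carrier G"
    and D: "D \<subseteq> points Z" and E: "E \<subseteq> points Z"
    and cell: "cell_attachment G \<C> (gsub Z D) (gsub Z E) (\<lambda>x. x)"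
  obtains H n \<Phi> where "H \<in> \<C>" "attaches G H Z D E (ball_set n) (sphere_set n) \<Phi>"
proof -
  from cell obtain H n f \<Phi> where H: "H \<in> \<C>" and
    po: "pushout_square G (orbit_times G H (bdry_sphere n)) (gsub Z D) (orbit_times G H (disc n))
      (gsub Z E) f (\<lambda>a. a) (\<lambda>x. x) \<Phi>"
    unfolding cell_attachment_def by blast
  let ?R = "glue (points (orbit_times G H (bdry_sphere n))) f (\<lambda>a. a)"
  have pS: "points (orbit_times G H (bdry_sphere n)) = (lcosets\<^bsub>G\<^esub> H) \<times> sphere_set n"
    and pB: "points (orbit_times G H (disc n)) = (lcosets\<^bsub>G\<^esub> H) \<times> ball_set n"
    unfolding orbit_times_def by (simp_all add: topspace_coset_space[OF G] disc_eq bdry_sphere_eq)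
  have tB: "space_top (orbit_times G H (disc n)) =
      prod_topology (coset_space G H) (top_of_set (ball_set n))"
    unfolding orbit_times_def by (simp add: disc_eq)
  note po = po[unfolded pushout_square_def points_gsub[OF D] points_gsub[OF E] pB]
  have gf: "gmap G (orbit_times G H (bdry_sphere n)) (gsub Z D) f"
    and gid: "gmap G (gsub Z D) (gsub Z E) (\<lambda>x. x)"
    and g\<Phi>: "gmap G (orbit_times G H (disc n)) (gsub Z E) \<Phi>"
    and EU: "E = (\<lambda>x. x) ` D \<union> \<Phi> ` ((lcosets\<^bsub>G\<^esub> H) \<times> ball_set n)"
    and rel: "\<forall>u \<in> D <+> (lcosets\<^bsub>G\<^esub> H) \<times> ball_set n.
      \<forall>v \<in> D <+> (lcosets\<^bsub>G\<^esub> H) \<times> ball_set n.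
      case_sum (\<lambda>x. x) \<Phi> u = case_sum (\<lambda>x. x) \<Phi> v \<longleftrightarrow> (u, v) \<in> (?R \<union> ?R\<inverse>)\<^sup>*"
    and fin: "\<forall>V \<subseteq> E. openin (space_top (gsub Z E)) V \<longleftrightarrow>
        openin (space_top (gsub Z D)) {x \<in> D. x \<in> V} \<and>
        openin (space_top (orbit_times G H (disc n))) {l \<in> (lcosets\<^bsub>G\<^esub> H) \<times> ball_set n. \<Phi> l \<in> V}"
    using po by - (elim conjE, assumption)+
  have fD: "f p \<in> D" if "p \<in> (lcosets\<^bsub>G\<^esub> H) \<times> sphere_set n" for p
  proof -
    have "f p \<in> points (gsub Z D)"
      using gf that pS unfolding gmap_def by (auto simp: continuous_map_def Pi_iff)
    then show ?thesis using points_gsub[OF D] by blast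
  qed
  have \<Phi>f: "\<Phi> p = f p" if p: "p \<in> (lcosets\<^bsub>G\<^esub> H) \<times> sphere_set n" for p
  proof -
    have "(Inl (f p), Inr p) \<in> ?R"
      using p unfolding glue_def pS by blast
    then have "(Inl (f p), Inr p) \<in> (?R \<union> ?R\<inverse>)\<^sup>*" by blast
    moreover have "p \<in> (lcosets\<^bsub>G\<^esub> H) \<times> ball_set n"
      using p sphere_subset_ball by blast
    ultimately show ?thesis
      using rel[rule_format, OF InlI[OF fD[OF p]] InrI, of p] by simp
  qed
  have out: "v = Inr p"
    if "p \<in> (lcosets\<^bsub>G\<^esub> H) \<times> (ball_set n - sphere_set n)" "v \<in> D <+> ((lcosets\<^bsub>G\<^esub> H) \<times> ball_set n)"
      and "\<Phi> p = case_sum (\<lambda>x. x) \<Phi> v" for p v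
  proof (rule glue_related_outside)
    have "p \<in> (lcosets\<^bsub>G\<^esub> H) \<times> ball_set n" using that(1) by blast
    then show "(Inr p, v) \<in> (?R \<union> ?R\<inverse>)\<^sup>*"
      using rel[rule_format, OF InrI that(2), of p] that(3) by simp
    show "p \<notin> (\<lambda>a. a) ` points (orbit_times G H (bdry_sphere n))"
      using that(1) pS by auto
  qed
  have "attaches G H Z D E (ball_set n) (sphere_set n) \<Phi>"
    unfolding attaches_def
  proof (intro conjI)
    show "sphere_set n \<subseteq> ball_set n" by (rule sphere_subset_ball)
    show "E = D \<union> \<Phi> ` ((lcosets\<^bsub>G\<^esub> H) \<times> ball_set n)" using EU by simp
    show "\<Phi> ` ((lcosets\<^bsub>G\<^esub> H) \<times> sphere_set n) \<subseteq> D" using \<Phi>f fD by fastforce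
    show "inj_on \<Phi> ((lcosets\<^bsub>G\<^esub> H) \<times> (ball_set n - sphere_set n))"
    proof (rule inj_onI)
      fix p q assume pq: "p \<in> (lcosets\<^bsub>G\<^esub> H) \<times> (ball_set n - sphere_set n)"
        "q \<in> (lcosets\<^bsub>G\<^esub> H) \<times> (ball_set n - sphere_set n)" "\<Phi> p = \<Phi> q"
      then show "p = q" using out[of p "Inr q"] by auto
    qed
    have False if "p \<in> (lcosets\<^bsub>G\<^esub> H) \<times> (ball_set n - sphere_set n)" "\<Phi> p \<in> D" for p
      using out[of p "Inl (\<Phi> p)"] that by auto
    then show "\<Phi> ` ((lcosets\<^bsub>G\<^esub> H) \<times> (ball_set n - sphere_set n)) \<inter> D = {}" by blast
    show "continuous_map (prod_topology (coset_space G H) (top_of_set (ball_set n))) (space_top Z) \<Phi>"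
      using g\<Phi> unfolding gmap_def gsub_def tB by (simp add: continuous_map_in_subtopology)
    show "\<forall>g\<in>carrier G. \<forall>c\<in>lcosets\<^bsub>G\<^esub> H. \<forall>y\<in>ball_set n.
        \<Phi> (g <#\<^bsub>G\<^esub> c, y) = act Z g (\<Phi> (c, y))"
      using g\<Phi> unfolding gmap_def gsub_def
      by (auto simp: orbit_times_def topspace_coset_space[OF G] disc_eq)
    show "\<forall>V \<subseteq> E. openin (subtopology (space_top Z) D) (V \<inter> D) \<longrightarrow>
        openin (prod_topology (coset_space G H) (top_of_set (ball_set n)))
          {p \<in> (lcosets\<^bsub>G\<^esub> H) \<times> ball_set n. \<Phi> p \<in> V} \<longrightarrow>
        openin (subtopology (space_top Z) E) V"
    proof (intro allI impI)
      fix V assume "V \<subseteq> E" and o: "openin (subtopology (space_top Z) D) (V \<inter> D)"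
        "openin (prod_topology (coset_space G H) (top_of_set (ball_set n)))
          {p \<in> (lcosets\<^bsub>G\<^esub> H) \<times> ball_set n. \<Phi> p \<in> V}"
      have "{x \<in> D. x \<in> V} = V \<inter> D" by blast
      with fin[rule_format, OF \<open>V \<subseteq> E\<close>] o show "openin (subtopology (space_top Z) E) V"
        unfolding tB by (simp add: gsub_def)
    qed
  qed
  then show thesis using that H by blast
qed

lemma attaches_imp_cell_attachment:
  assumes G: "topspace (gtopology G) = carrier G"
    and D: "D \<subseteq> points Z" and E: "E \<subseteq> points Z"
    and H: "H \<in> \<C>" and att: "attaches G H Z D E (ball_set n) (sphere_set n) \<Phi>"
  shows "cell_attachment G \<C> (gsub Z D) (gsub Z E) (\<lambda>x. x)"
proof -
  note a = attachesD[OF att]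
  let ?S = "orbit_times G H (bdry_sphere n)" and ?B = "orbit_times G H (disc n)"
  let ?R = "glue (points ?S) \<Phi> (\<lambda>a. a)"
  have pS: "points ?S = (lcosets\<^bsub>G\<^esub> H) \<times> sphere_set n"
    and pB: "points ?B = (lcosets\<^bsub>G\<^esub> H) \<times> ball_set n"
    unfolding orbit_times_def by (simp_all add: topspace_coset_space[OF G] disc_eq bdry_sphere_eq)
  have tB: "space_top ?B = prod_topology (coset_space G H) (top_of_set (ball_set n))"
    unfolding orbit_times_def by (simp add: disc_eq)
  have tS: "space_top ?S = subtopology (space_top ?B) (topspace (coset_space G H) \<times> sphere_set n)"
  proof -
    have "top_of_set (sphere_set n) = subtopology (top_of_set (ball_set n)) (sphere_set n)"
      using sphere_subset_ball[of n] by (simp add: subtopology_subtopology Int_absorb1)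
    then show ?thesis
      using prod_topology_subtopology(2)[of "coset_space G H" "top_of_set (ball_set n)" "sphere_set n"]
      unfolding orbit_times_def by (simp add: disc_eq bdry_sphere_eq)
  qed
  have DE: "D \<subseteq> E" and \<Phi>E: "\<Phi> ` ((lcosets\<^bsub>G\<^esub> H) \<times> ball_set n) \<subseteq> E" using a(2) by blast+
  have g\<Phi>: "gmap G ?B (gsub Z E) \<Phi>"
    unfolding gmap_def gsub_def
  proof (intro conjI ballI)
    show "continuous_map (space_top ?B) (space_top \<lparr>space_top = subtopology (space_top Z) E, act = act Z\<rparr>) \<Phi>"
      using a(6) \<Phi>E pB by (auto simp: continuous_map_in_subtopology tB topspace_coset_space[OF G])
    fix g p assume "g \<in> carrier G" "p \<in> points ?B"
    then show "\<Phi> (act ?B g p) = act \<lparr>space_top = subtopology (space_top Z) E, act = act Z\<rparr> g (\<Phi> p)"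
      using a(7) by (auto simp: orbit_times_def topspace_coset_space[OF G] disc_eq)
  qed
  have \<Phi>D: "\<Phi> p \<in> D" if "p \<in> points ?S" for p
    using that a(3) unfolding pS by auto
  have gf: "gmap G ?S (gsub Z D) \<Phi>"
    unfolding gmap_def
  proof (intro conjI ballI)
    have "continuous_map (space_top ?S) (space_top Z) \<Phi>"
      unfolding tS tB by (rule continuous_map_from_subtopology[OF a(6)])
    then show "continuous_map (space_top ?S) (space_top (gsub Z D)) \<Phi>"
      using \<Phi>D by (auto simp: gsub_def continuous_map_in_subtopology)
    fix g p assume "g \<in> carrier G" "p \<in> points ?S"
    then show "\<Phi> (act ?S g p) = act (gsub Z D) g (\<Phi> p)"
      using a(7) subsetD[OF sphere_subset_ball[of n]]
      by (auto simp: orbit_times_def gsub_def topspace_coset_space[OF G] bdry_sphere_eq)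
  qed
  have gj: "gmap G ?S ?B (\<lambda>a. a)"
    unfolding gmap_def tS
    by (auto intro: continuous_map_from_subtopology simp: orbit_times_def)
  have gi: "gmap G (gsub Z D) (gsub Z E) (\<lambda>x. x)"
    using DE unfolding gmap_def gsub_def
    by (auto simp: continuous_map_in_subtopology intro: continuous_map_from_subtopology)
  have eq_imp: "(u, v) \<in> (?R \<union> ?R\<inverse>)\<^sup>*"
    if u: "u \<in> D <+> points ?B" and v: "v \<in> D <+> points ?B"
      and eq: "case_sum (\<lambda>x. x) \<Phi> u = case_sum (\<lambda>x. x) \<Phi> v" for u v
  proof -
    have base: "(Inr p, Inl (\<Phi> p)) \<in> (?R \<union> ?R\<inverse>)\<^sup>*" "(Inl (\<Phi> p), Inr p) \<in> (?R \<union> ?R\<inverse>)\<^sup>*"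
      if "p \<in> points ?S" for p
      using that unfolding glue_def by blast+
    have mem: "p \<in> points ?S" if "p \<in> points ?B" "\<Phi> p \<in> D" for p
      using that a(5) unfolding pB pS by auto
    show ?thesis
    proof (cases u)
      case (Inl x)
      show ?thesis
      proof (cases v)
        case (Inr q)
        then have "q \<in> points ?S" using mem[of q] u v eq Inl by auto
        then show ?thesis using base(2)[of q] eq Inl Inr by auto
      qed (use eq Inl in auto)
    next
      case (Inr p)
      show ?thesis
      proof (cases v)
        case (Inl x)
        then have "p \<in> points ?S" using mem[of p] u v eq Inr by auto
        then show ?thesis using base(1)[of p] eq Inl Inr by auto
      next
        case (Inr q)
        have e: "\<Phi> p = \<Phi> q" using eq Inr \<open>u = Inr p\<close> by simp
        have pq: "p \<in> points ?B" "q \<in> points ?B" using u v Inr \<open>u = Inr p\<close> by auto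
        show ?thesis
        proof (cases "\<Phi> p \<in> D")
          case True
          then have "p \<in> points ?S" "q \<in> points ?S" using mem pq e by auto
          then show ?thesis
            using base(1)[of p] base(2)[of q] e Inr \<open>u = Inr p\<close> by (auto intro: rtrancl_trans)
        next
          case False
          then have "p \<notin> points ?S" "q \<notin> points ?S" using \<Phi>D[of p] \<Phi>D[of q] e by metis+
          then have "p = q"
            using pq inj_onD[OF a(4) e] unfolding pB pS by auto
          then show ?thesis using Inr \<open>u = Inr p\<close> by simp
        qed
      qed
    qed
  qed
  have imp_eq: "case_sum (\<lambda>x. x) \<Phi> u = case_sum (\<lambda>x. x) \<Phi> v"
    if "(u, v) \<in> (?R \<union> ?R\<inverse>)\<^sup>*" for u v
    using that
  proof (induction rule: rtrancl_induct)
    case (step y z)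
    then show ?case unfolding glue_def by auto
  qed simp
  have fin: "openin (space_top (gsub Z E)) V \<longleftrightarrow>
      openin (space_top (gsub Z D)) {x \<in> D. x \<in> V} \<and> openin (space_top ?B) {p \<in> points ?B. \<Phi> p \<in> V}"
    if "V \<subseteq> E" for V
  proof
    have eq: "{x \<in> D. x \<in> V} = V \<inter> D" by blast
    show "openin (space_top (gsub Z E)) V"
      if "openin (space_top (gsub Z D)) {x \<in> D. x \<in> V} \<and> openin (space_top ?B) {p \<in> points ?B. \<Phi> p \<in> V}"
      using a(8)[OF \<open>V \<subseteq> E\<close>] that unfolding pB tB eq gsub_def by (simp add: topspace_coset_space[OF G])
    assume o: "openin (space_top (gsub Z E)) V"
    have "openin (space_top ?B) {p \<in> points ?B. \<Phi> p \<in> V}"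
      using g\<Phi> o unfolding gmap_def by (auto intro: openin_continuous_map_preimage)
    moreover have "openin (space_top (gsub Z D)) {x \<in> D. x \<in> V}"
      using o openin_subtopology_trans[OF _ DE] unfolding eq gsub_def by simp
    ultimately show "openin (space_top (gsub Z D)) {x \<in> D. x \<in> V} \<and>
        openin (space_top ?B) {p \<in> points ?B. \<Phi> p \<in> V}" by simp
  qed
  have "pushout_square G ?S (gsub Z D) ?B (gsub Z E) \<Phi> (\<lambda>a. a) (\<lambda>x. x) \<Phi>"
    unfolding pushout_square_def points_gsub[OF D] points_gsub[OF E]
  proof (intro conjI ballI allI impI gf gj gi g\<Phi>)
    show "E = (\<lambda>x. x) ` D \<union> \<Phi> ` points ?B" using a(2) unfolding pB by simp
    show "case_sum (\<lambda>x. x) \<Phi> u = case_sum (\<lambda>x. x) \<Phi> v \<longleftrightarrow> (u, v) \<in> (?R \<union> ?R\<inverse>)\<^sup>*"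
      if "u \<in> D <+> points ?B" "v \<in> D <+> points ?B" for u v
      using eq_imp[OF that] imp_eq[of u v] by (rule iffI)
  qed (rule fin)
  then show ?thesis unfolding cell_attachment_def using H by blast
qed

text \<open>
  Cells may be reparametrised; this lets a disc be traded for any box of the same dimension.
\<close>

lemma attaches_homeomorphic:
  assumes G: "topspace (gtopology G) = carrier G"
    and att: "attaches G H Z D E K L \<Psi>" and hom: "homeomorphism K' K \<phi> \<phi>'" and L: "\<phi> ` L' = L" and L': "L' \<subseteq> K'"
  shows "attaches G H Z D E K' L' (\<lambda>(c, y). \<Psi> (c, \<phi> y))"
proof -
  note a = attachesD[OF att]
  note h = homeomorphism_image1[OF hom] homeomorphism_apply1[OF hom] homeomorphism_apply2[OF hom]
  have inj: "inj_on \<phi> K'" using h(2) by (rule inj_on_inverseI)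
  have \<phi>'K: "\<phi>' y \<in> K'" if "y \<in> K" for y
    using homeomorphism_image2[OF hom] that by blast
  have int: "\<phi> y \<in> K - L" if "y \<in> K' - L'" for y
    using that h(1) L L' inj by (auto dest: inj_onD)
  have cont: "continuous_map (prod_topology (coset_space G H) (top_of_set K'))
      (prod_topology (coset_space G H) (top_of_set K)) (\<lambda>(c, y). (c, \<phi> y))"
    using homeomorphism_cont1[OF hom] h(1)
    by (auto simp: case_prod_beta' intro!: continuous_map_pairedI continuous_map_fst
        continuous_map_compose[OF continuous_map_snd, unfolded o_def])
  have cont': "continuous_map (prod_topology (coset_space G H) (top_of_set K))
      (prod_topology (coset_space G H) (top_of_set K')) (\<lambda>(c, y). (c, \<phi>' y))"
    using homeomorphism_cont2[OF hom] homeomorphism_image2[OF hom]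
    by (auto simp: case_prod_beta' intro!: continuous_map_pairedI continuous_map_fst
        continuous_map_compose[OF continuous_map_snd, unfolded o_def])
  have img: "(\<lambda>(c, y). \<Psi> (c, \<phi> y)) ` (A \<times> B) = \<Psi> ` (A \<times> \<phi> ` B)" for A B
    by force
  show ?thesis
    unfolding attaches_def img h(1) L
  proof (intro conjI)
    show "inj_on (\<lambda>(c, y). \<Psi> (c, \<phi> y)) ((lcosets\<^bsub>G\<^esub> H) \<times> (K' - L'))"
    proof (rule inj_onI, clarify)
      fix c y c' y'
      assume m: "c \<in> lcosets\<^bsub>G\<^esub> H" "c' \<in> lcosets\<^bsub>G\<^esub> H" "y \<in> K'" "y \<notin> L'" "y' \<in> K'" "y' \<notin> L'"
        and "\<Psi> (c, \<phi> y) = \<Psi> (c', \<phi> y')"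
      then have "(c, \<phi> y) = (c', \<phi> y')"
        using inj_onD[OF a(4)] int by blast
      then show "c = c' \<and> y = y'" using inj_onD[OF inj] m by blast
    qed
    show "\<Psi> ` ((lcosets\<^bsub>G\<^esub> H) \<times> \<phi> ` (K' - L')) \<inter> D = {}"
      using a(5) int by blast
    show "continuous_map (prod_topology (coset_space G H) (top_of_set K')) (space_top Z)
        (\<lambda>(c, y). \<Psi> (c, \<phi> y))"
      using continuous_map_compose[OF cont a(6)] by (simp add: o_def case_prod_beta')
    show "\<forall>g\<in>carrier G. \<forall>c\<in>lcosets\<^bsub>G\<^esub> H. \<forall>y\<in>K'. (case (g <#\<^bsub>G\<^esub> c, y) of (c, y) \<Rightarrow> \<Psi> (c, \<phi> y)) =
        act Z g (case (c, y) of (c, y) \<Rightarrow> \<Psi> (c, \<phi> y))"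
      using a(7) h(1) by auto
    show "\<forall>V\<subseteq>E. openin (subtopology (space_top Z) D) (V \<inter> D) \<longrightarrow>
        openin (prod_topology (coset_space G H) (top_of_set K'))
         {p \<in> (lcosets\<^bsub>G\<^esub> H) \<times> K'. (case p of (c, y) \<Rightarrow> \<Psi> (c, \<phi> y)) \<in> V} \<longrightarrow>
        openin (subtopology (space_top Z) E) V"
    proof (intro allI impI)
      fix V assume V: "V \<subseteq> E" "openin (subtopology (space_top Z) D) (V \<inter> D)"
        and o: "openin (prod_topology (coset_space G H) (top_of_set K'))
         {p \<in> (lcosets\<^bsub>G\<^esub> H) \<times> K'. (case p of (c, y) \<Rightarrow> \<Psi> (c, \<phi> y)) \<in> V}" (is "openin _ ?O")
      have "{p \<in> topspace (prod_topology (coset_space G H) (top_of_set K)). (\<lambda>(c, y). (c, \<phi>' y)) p \<in> ?O}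
          = {p \<in> (lcosets\<^bsub>G\<^esub> H) \<times> K. \<Psi> p \<in> V}"
        using h(3) \<phi>'K by (auto simp: topspace_coset_space[OF G])
      with openin_continuous_map_preimage[OF cont' o]
      show "openin (subtopology (space_top Z) E) V" using a(8)[OF V] by simp
    qed
  qed (use a(1-3) L L' in auto)
qed

section \<open>Discs and boxes\<close>

text \<open>
  The box lives in the first \<open>n\<close> coordinates and may be degenerate: sides with \<open>a i = b i\<close> are points, and
  \<open>cbox_frontier\<close> is the relative frontier, in which only the nondegenerate sides count. In this way
  all faces of a grid are boxes in the same ambient space.
\<close>

definition cbox_set :: "nat \<Rightarrow> (nat \<Rightarrow> real) \<Rightarrow> (nat \<Rightarrow> real) \<Rightarrow> (nat \<Rightarrow> real) set" where
  "cbox_set n a b = {y. (\<forall>i\<ge>n. y i = 0) \<and> (\<forall>i<n. a i \<le> y i \<and> y i \<le> b i)}"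

definition cbox_frontier :: "nat \<Rightarrow> (nat \<Rightarrow> real) \<Rightarrow> (nat \<Rightarrow> real) \<Rightarrow> (nat \<Rightarrow> real) set" where
  "cbox_frontier n a b = {y \<in> cbox_set n a b. \<exists>i<n. a i < b i \<and> (y i = a i \<or> y i = b i)}"

lemma continuous_on_coordinate: "continuous_on S (\<lambda>x::nat \<Rightarrow> real. x i)"
  by (rule continuous_on_subset[OF continuous_on_product_coordinates subset_UNIV])

lemma closed_coordinate_le: "closed {x::nat \<Rightarrow> real. \<forall>i\<in>I. l i \<le> x i \<and> x i \<le> u i}"
proof -
  have "{x::nat \<Rightarrow> real. \<forall>i\<in>I. l i \<le> x i \<and> x i \<le> u i} =
      (\<Inter>i\<in>I. {x. l i \<le> x i} \<inter> {x. x i \<le> u i})"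
    by auto
  then show ?thesis
    by (simp only:) (intro closed_INT ballI closed_Int
        closed_Collect_le[OF continuous_on_const continuous_on_coordinate]
        closed_Collect_le[OF continuous_on_coordinate continuous_on_const])
qed

lemma closed_cbox_set: "closed (cbox_set n a b)"
proof -
  have "cbox_set n a b = {x. \<forall>i\<in>{n..}. 0 \<le> x i \<and> x i \<le> 0} \<inter> {x. \<forall>i\<in>{..<n}. a i \<le> x i \<and> x i \<le> b i}"
    unfolding cbox_set_def by (fastforce simp: eq_iff)
  then show ?thesis
    using closed_coordinate_le by (simp add: closed_Int)
qed

lemma compact_bounded_coordinates:
  fixes S :: "(nat \<Rightarrow> real) set"
  assumes "closed S" "\<And>x i. x \<in> S \<Longrightarrow> \<bar>x i\<bar> \<le> 1"
  shows "compact S"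
proof -
  have "compactin (product_topology (\<lambda>i. euclidean) UNIV) (PiE UNIV (\<lambda>i::nat. {-1..1::real}))"
    unfolding compactin_PiE by simp
  then have "compact (PiE UNIV (\<lambda>i::nat. {-1..1::real}))"
    by (simp add: euclidean_product_topology)
  moreover have "S \<subseteq> PiE UNIV (\<lambda>i::nat. {-1..1::real})"
    using assms(2) by (auto simp: PiE_iff abs_le_iff)
  ultimately show ?thesis
    using assms(1) by (metis compact_Int_closed inf.absorb2)
qed

definition norm2 :: "nat \<Rightarrow> (nat \<Rightarrow> real) \<Rightarrow> real" where
  "norm2 d x = L2_set x {..<d}"

primrec maxnorm :: "nat \<Rightarrow> (nat \<Rightarrow> real) \<Rightarrow> real" where
  "maxnorm 0 x = 0"
| "maxnorm (Suc d) x = max \<bar>x d\<bar> (maxnorm d x)"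

lemma maxnorm_nonneg: "0 \<le> maxnorm d x"
  by (induction d) auto

lemma maxnorm_le_iff: "maxnorm d x \<le> t \<longleftrightarrow> 0 \<le> t \<and> (\<forall>i<d. \<bar>x i\<bar> \<le> t)"
  by (induction d) (auto simp: less_Suc_eq)

lemma maxnorm_ge_iff: "0 < t \<Longrightarrow> t \<le> maxnorm d x \<longleftrightarrow> (\<exists>i<d. t \<le> \<bar>x i\<bar>)"
  by (induction d) (auto simp: less_Suc_eq le_max_iff_disj)

lemma maxnorm_scale: "0 \<le> c \<Longrightarrow> maxnorm d (\<lambda>i. x i * c) = maxnorm d x * c"
  by (induction d) (auto simp: abs_mult max_mult_distrib_right)

lemma norm2_scale: "0 \<le> c \<Longrightarrow> norm2 d (\<lambda>i. x i * c) = norm2 d x * c"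
  unfolding norm2_def by (simp add: L2_set_left_distrib)

lemma continuous_maxnorm: "continuous_on S (maxnorm d)"
  by (induction d)
    (simp_all add: continuous_on_max continuous_on_rabs continuous_on_coordinate continuous_on_const)

lemma continuous_norm2: "continuous_on S (norm2 d)"
  unfolding norm2_def L2_set_def by (intro continuous_intros continuous_on_coordinate)

lemma maxnorm_eq_0_iff: "maxnorm d x = 0 \<longleftrightarrow> (\<forall>i<d. x i = 0)"
  using maxnorm_le_iff[of d x 0] maxnorm_nonneg[of d x] by (simp add: order_antisym_conv)

lemma norm2_eq_0_iff: "norm2 d x = 0 \<longleftrightarrow> (\<forall>i<d. x i = 0)"
  unfolding norm2_def by (simp add: L2_set_eq_0_iff lessThan_def)

lemma norm2_nonneg: "0 \<le> norm2 d x"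
  unfolding norm2_def by (rule L2_set_nonneg)

lemma ball_set_norm2: "ball_set d = {x. (\<forall>i\<ge>d. x i = 0) \<and> norm2 d x \<le> 1}"
  unfolding ball_set_def norm2_def L2_set_def by simp

lemma sphere_set_norm2: "sphere_set d = {x. (\<forall>i\<ge>d. x i = 0) \<and> norm2 d x = 1}"
  unfolding sphere_set_def norm2_def L2_set_def by simp

lemma compact_ball_set: "compact (ball_set d)"
proof (rule compact_bounded_coordinates)
  have "ball_set d = {x. \<forall>i\<in>{d..}. 0 \<le> x i \<and> x i \<le> 0} \<inter> {x. norm2 d x \<le> 1}"
    unfolding ball_set_norm2 by (fastforce simp: eq_iff)
  then show "closed (ball_set d)"
    using closed_coordinate_le
    by (auto intro!: closed_Int closed_Collect_le[OF continuous_norm2 continuous_on_const])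
  show "\<bar>x i\<bar> \<le> 1" if "x \<in> ball_set d" for x i
  proof (cases "i < d")
    case True
    then have "\<bar>x i\<bar> \<le> norm2 d x"
      unfolding norm2_def L2_set_def using member_le_sum[of i "{..<d}" "\<lambda>i. (x i)\<^sup>2"]
      by (intro real_le_rsqrt) simp
    then show ?thesis using that unfolding ball_set_norm2 by auto
  qed (use that in \<open>auto simp: ball_set_def\<close>)
qed

lemma homeomorphism_image_Collect:
  assumes "homeomorphism S T f g" "\<And>x. x \<in> S \<Longrightarrow> P x \<longleftrightarrow> Q (f x)"
  shows "f ` {x \<in> S. P x} = {y \<in> T. Q y}"
  using assms unfolding homeomorphism_def by (auto simp: image_iff)

text \<open>
  Rescaling each ray so that the Euclidean norm becomes the maximum norm. At the origin the quotient
  of the norms is undefined, but the image is bounded by the Euclidean norm, which gives continuity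
  there; the inverse is continuous because the ball is compact.
\<close>

lemma ball_cube_homeomorphism:
  obtains f g where "homeomorphism (ball_set d) (cbox_set d (\<lambda>_. -1) (\<lambda>_. 1)) f g"
    "f ` sphere_set d = cbox_frontier d (\<lambda>_. -1) (\<lambda>_. 1)"
proof -
  let ?C = "cbox_set d (\<lambda>_. -1) (\<lambda>_. 1)"
  define E where "E = {x::nat \<Rightarrow> real. \<forall>i\<ge>d. x i = 0}"
  define f where "f x = (\<lambda>i. x i * (norm2 d x / maxnorm d x))" for x
  define g where "g x = (\<lambda>i. x i * (maxnorm d x / norm2 d x))" for x
  have C: "?C = {x \<in> E. maxnorm d x \<le> 1}"
    unfolding cbox_set_def E_def maxnorm_le_iff by (auto simp: abs_le_iff)
  have B: "ball_set d = {x \<in> E. norm2 d x \<le> 1}"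
    unfolding ball_set_norm2 E_def by auto
  have nz: "maxnorm d x = 0 \<longleftrightarrow> norm2 d x = 0" for x
    unfolding maxnorm_eq_0_iff norm2_eq_0_iff ..
  have mf: "maxnorm d (f x) = norm2 d x" for x
    unfolding f_def using nz[of x] maxnorm_nonneg[of d x] norm2_nonneg[of d x]
    by (subst maxnorm_scale) auto
  have ng: "norm2 d (g x) = maxnorm d x" for x
    unfolding g_def using nz[of x] maxnorm_nonneg[of d x] norm2_nonneg[of d x]
    by (subst norm2_scale) auto
  have nf: "norm2 d (f x) = norm2 d x * (norm2 d x / maxnorm d x)" for x
    unfolding f_def using maxnorm_nonneg[of d x] norm2_nonneg[of d x]
    by (subst norm2_scale) auto
  have mg: "maxnorm d (g x) = maxnorm d x * (maxnorm d x / norm2 d x)" for x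
    unfolding g_def using maxnorm_nonneg[of d x] norm2_nonneg[of d x]
    by (subst maxnorm_scale) auto
  have zero: "x i = 0" if "x \<in> E" "norm2 d x = 0" for x i
    using that unfolding E_def norm2_eq_0_iff by (cases "i < d") auto
  have gf: "g (f x) = x" if "x \<in> E" for x
  proof
    fix i
    show "g (f x) i = x i"
    proof (cases "norm2 d x = 0")
      case False
      then show ?thesis
        using nz[of x] unfolding g_def[of "f x"] mf nf by (simp add: f_def)
    qed (simp add: g_def f_def zero[OF that])
  qed
  have fg: "f (g x) = x" if "x \<in> E" for x
  proof
    fix i
    show "f (g x) i = x i"
    proof (cases "norm2 d x = 0")
      case False
      then show ?thesis
        using nz[of x] unfolding f_def[of "g x"] mg ng by (simp add: g_def)
    qed (simp add: g_def f_def zero[OF that])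
  qed
  have fE: "f x \<in> E" and gE: "g x \<in> E" if "x \<in> E" for x
    using that unfolding E_def f_def g_def by auto
  have cont: "continuous_on (ball_set d) f"
  proof (rule continuous_on_coordinatewise_then_product)
    fix i
    show "continuous_on (ball_set d) (\<lambda>x. f x i)"
      unfolding continuous_on_eq_continuous_within
    proof
      fix x assume x: "x \<in> ball_set d"
      have c: "continuous (at x within ball_set d) (maxnorm d)"
        "continuous (at x within ball_set d) (norm2 d)"
        "continuous (at x within ball_set d) (\<lambda>x. x i)"
        using x continuous_maxnorm continuous_norm2 continuous_on_coordinate
        by (simp_all add: continuous_on_eq_continuous_within)
      show "continuous (at x within ball_set d) (\<lambda>x. f x i)"
      proof (cases "maxnorm d x = 0")
        case False
        then show ?thesis
          unfolding f_def by (intro continuous_intros c)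
      next
        case True
        then have n0: "norm2 d x = 0" using nz by simp
        have "f x i = 0" unfolding f_def using n0 by simp
        have bound: "norm (f y i) \<le> norm2 d y" if "y \<in> E" for y
        proof -
          have "\<bar>f y i\<bar> \<le> maxnorm d (f y)"
          proof (cases "i < d")
            case True
            then show ?thesis using maxnorm_le_iff[of d "f y" "maxnorm d (f y)"] by simp
          next
            case False
            then have "f y i = 0" using fE[OF that] unfolding E_def by simp
            then show ?thesis using maxnorm_nonneg[of d "f y"] by simp
          qed
          then show ?thesis using mf by simp
        qed
        \<comment> \<open>Here \<open>x\<close> is the origin, the one point at which the quotient of the norms is not continuous.\<close>
        have "((\<lambda>y. f y i) \<longlongrightarrow> 0) (at x within ball_set d)"
        proof (rule Lim_null_comparison)
          show "\<forall>\<^sub>F y in at x within ball_set d. norm (f y i) \<le> norm2 d y"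
            unfolding eventually_at_topological using bound B by auto
          show "((\<lambda>y. norm2 d y) \<longlongrightarrow> 0) (at x within ball_set d)"
            using c(2) n0 unfolding continuous_within by simp
        qed
        then show ?thesis
          unfolding continuous_within \<open>f x i = 0\<close> .
      qed
    qed
  qed
  have img: "f ` ball_set d = ?C"
  proof (intro subset_antisym subsetI)
    fix y assume "y \<in> f ` ball_set d"
    then show "y \<in> ?C" unfolding C B using fE mf by auto
  next
    fix y assume y: "y \<in> ?C"
    then have "g y \<in> ball_set d" "f (g y) = y" unfolding C B using gE ng fg by auto
    then show "y \<in> f ` ball_set d" by force
  qed
  have "inj_on f (ball_set d)"
    by (rule inj_on_inverseI[of _ g]) (use gf B in auto)
  then obtain h where h: "homeomorphism (ball_set d) ?C f h"
    using homeomorphism_compact[OF compact_ball_set cont img] by blast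
  have front: "cbox_frontier d (\<lambda>_. -1) (\<lambda>_. 1) = {y \<in> ?C. maxnorm d y = 1}"
  proof -
    have "(\<exists>i<d. y i = -1 \<or> y i = 1) \<longleftrightarrow> maxnorm d y = 1" if y: "y \<in> ?C" for y
    proof -
      have le: "maxnorm d y \<le> 1" using y C by blast
      have "maxnorm d y = 1 \<longleftrightarrow> (\<exists>i<d. 1 \<le> \<bar>y i\<bar>)"
        using maxnorm_ge_iff[OF zero_less_one, of d y] le by (metis order_antisym order_refl)
      moreover have "1 \<le> \<bar>y i\<bar> \<longleftrightarrow> y i = -1 \<or> y i = 1" if "i < d" for i
        using y that unfolding cbox_set_def by fastforce
      ultimately show ?thesis by metis
    qed
    then show ?thesis unfolding cbox_frontier_def by auto
  qed
  have sph: "sphere_set d = {x \<in> ball_set d. norm2 d x = 1}"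
    unfolding sphere_set_norm2 ball_set_norm2 by auto
  have "f ` sphere_set d = cbox_frontier d (\<lambda>_. -1) (\<lambda>_. 1)"
    unfolding sph front by (rule homeomorphism_image_Collect[OF h]) (simp add: mf)
  then show thesis using h that by blast
qed

text \<open>
  An affine map in the nondegenerate coordinates \<open>J\<close>, which have to be renumbered as \<open>0, ..., d - 1\<close>
  because a \<open>d\<close>-dimensional disc occupies the first \<open>d\<close> coordinates.
\<close>

lemma cube_cbox_homeomorphism:
  assumes ab: "\<And>i. i < n \<Longrightarrow> a i \<le> b i" and d: "d = card {i. i < n \<and> a i < b i}"
  obtains f g where "homeomorphism (cbox_set d (\<lambda>_. -1) (\<lambda>_. 1)) (cbox_set n a b) f g"
    "f ` cbox_frontier d (\<lambda>_. -1) (\<lambda>_. 1) = cbox_frontier n a b"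
proof -
  define J where "J = {i. i < n \<and> a i < b i}"
  have "finite J" unfolding J_def by simp
  then obtain e where e: "bij_betw e {..<d} J"
    using ex_bij_betw_nat_finite[of J] d unfolding J_def atLeast0LessThan by auto
  define e' where "e' = the_inv_into {..<d} e"
  have e'e: "e' (e j) = j" if "j < d" for j
    unfolding e'_def using e that by (auto simp: bij_betw_def intro: the_inv_into_f_f)
  have ee': "e (e' i) = i" "e' i < d" if "i \<in> J" for i
    using bij_betw_the_inv_into[OF e] e that f_the_inv_into_f_bij_betw[OF e]
    unfolding e'_def bij_betw_def by auto
  have eJ: "e j \<in> J" if "j < d" for j
    using e that unfolding bij_betw_def by auto
  define f where "f y = (\<lambda>i. if i \<in> J then (a i + b i) / 2 + (b i - a i) / 2 * y (e' i)
    else if i < n then a i else 0)" for y :: "nat \<Rightarrow> real"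
  define g where "g z = (\<lambda>j. if j < d then (2 * z (e j) - a (e j) - b (e j)) / (b (e j) - a (e j)) else 0)"
    for z :: "nat \<Rightarrow> real"
  have pos: "b i - a i > 0" if "i \<in> J" for i using that unfolding J_def by auto
  have notJ: "a i = b i" if "i < n" "i \<notin> J" for i using ab[OF that(1)] that unfolding J_def by auto
  have f_low: "f y i = a i \<longleftrightarrow> y (e' i) = -1" and f_high: "f y i = b i \<longleftrightarrow> y (e' i) = 1"
    and f_ge: "a i \<le> f y i \<longleftrightarrow> -1 \<le> y (e' i)" and f_le: "f y i \<le> b i \<longleftrightarrow> y (e' i) \<le> 1"
    if "i \<in> J" for i y
  proof -
    have 1: "f y i - a i = (b i - a i) / 2 * (y (e' i) + 1)" "b i - f y i = (b i - a i) / 2 * (1 - y (e' i))"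
      using that unfolding f_def by (simp_all add: field_simps)
    have p: "(b i - a i) / 2 > 0" using pos[OF that] by simp
    have z: "(b i - a i) / 2 * t = 0 \<longleftrightarrow> t = 0" "0 \<le> (b i - a i) / 2 * t \<longleftrightarrow> 0 \<le> t" for t
      using p by (simp_all add: zero_le_mult_iff)
    show "f y i = a i \<longleftrightarrow> y (e' i) = -1" using 1(1) z(1)[of "y (e' i) + 1"] by linarith
    show "f y i = b i \<longleftrightarrow> y (e' i) = 1" using 1(2) z(1)[of "1 - y (e' i)"] by linarith
    show "a i \<le> f y i \<longleftrightarrow> -1 \<le> y (e' i)" using 1(1) z(2)[of "y (e' i) + 1"] by linarith
    show "f y i \<le> b i \<longleftrightarrow> y (e' i) \<le> 1" using 1(2) z(2)[of "1 - y (e' i)"] by linarith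
  qed
  have fC: "f y \<in> cbox_set n a b" if "y \<in> cbox_set d (\<lambda>_. -1) (\<lambda>_. 1)" for y
  proof -
    have "a i \<le> f y i \<and> f y i \<le> b i" if "i < n" for i
    proof (cases "i \<in> J")
      case True
      then show ?thesis
        using f_ge f_le ee' \<open>y \<in> _\<close> unfolding cbox_set_def by auto
    qed (use that notJ in \<open>auto simp: f_def\<close>)
    moreover have "f y i = 0" if "i \<ge> n" for i
      using that unfolding f_def J_def by auto
    ultimately show ?thesis unfolding cbox_set_def by auto
  qed
  have fg: "f (g z) = z" if "z \<in> cbox_set n a b" for z
  proof
    fix i
    show "f (g z) i = z i"
    proof (cases "i \<in> J")
      case True
      then show ?thesis using ee'[OF True] pos[OF True] unfolding f_def g_def by (simp add: field_simps)
    next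
      case False
      then show ?thesis using that notJ[of i] unfolding f_def cbox_set_def by force
    qed
  qed
  have gf: "g (f y) = y" if "y \<in> cbox_set d (\<lambda>_. -1) (\<lambda>_. 1)" for y
  proof
    fix j
    show "g (f y) j = y j"
    proof (cases "j < d")
      case True
      then show ?thesis using e'e[OF True] eJ[OF True] pos[OF eJ[OF True]]
        unfolding f_def g_def by (simp add: field_simps)
    next
      case False
      then show ?thesis using that unfolding g_def cbox_set_def by auto
    qed
  qed
  have gC: "g z \<in> cbox_set d (\<lambda>_. -1) (\<lambda>_. 1)" if z: "z \<in> cbox_set n a b" for z
  proof -
    have "-1 \<le> g z j \<and> g z j \<le> 1" if j: "j < d" for j
    proof -
      have "a (e j) \<le> f (g z) (e j)" "f (g z) (e j) \<le> b (e j)"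
        using z eJ[OF j] unfolding fg[OF z] cbox_set_def J_def by auto
      then show ?thesis using f_ge[OF eJ[OF j]] f_le[OF eJ[OF j]] e'e[OF j] by auto
    qed
    then show ?thesis unfolding cbox_set_def by (auto simp: g_def)
  qed
  have hom: "homeomorphism (cbox_set d (\<lambda>_. -1) (\<lambda>_. 1)) (cbox_set n a b) f g"
  proof (rule homeomorphismI)
    show "continuous_on (cbox_set d (\<lambda>_. -1) (\<lambda>_. 1)) f"
    proof (rule continuous_on_coordinatewise_then_product)
      fix i show "continuous_on (cbox_set d (\<lambda>_. -1) (\<lambda>_. 1)) (\<lambda>y. f y i)"
        unfolding f_def by (cases "i \<in> J") (auto intro!: continuous_intros continuous_on_coordinate)
    qed
    show "continuous_on (cbox_set n a b) g"
    proof (rule continuous_on_coordinatewise_then_product)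
      fix j show "continuous_on (cbox_set n a b) (\<lambda>z. g z j)"
        unfolding g_def using pos[OF eJ, of j]
        by (cases "j < d") (auto intro!: continuous_intros continuous_on_coordinate)
    qed
  qed (use fC gC fg gf in auto)
  have "f ` cbox_frontier d (\<lambda>_. -1) (\<lambda>_. 1) = cbox_frontier n a b"
    unfolding cbox_frontier_def
  proof (rule homeomorphism_image_Collect[OF hom])
    fix y
    show "(\<exists>i<d. (-1::real) < 1 \<and> (y i = -1 \<or> y i = 1)) \<longleftrightarrow>
      (\<exists>i<n. a i < b i \<and> (f y i = a i \<or> f y i = b i))"
    proof
      assume "\<exists>i<d. (-1::real) < 1 \<and> (y i = -1 \<or> y i = 1)"
      then obtain j where j: "j < d" "y j = -1 \<or> y j = 1" by blast
      then have "e j < n \<and> a (e j) < b (e j) \<and> (f y (e j) = a (e j) \<or> f y (e j) = b (e j))"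
        using eJ[OF j(1)] f_low[OF eJ[OF j(1)]] f_high[OF eJ[OF j(1)]] e'e[OF j(1)] unfolding J_def by auto
      then show "\<exists>i<n. a i < b i \<and> (f y i = a i \<or> f y i = b i)" by blast
    next
      assume "\<exists>i<n. a i < b i \<and> (f y i = a i \<or> f y i = b i)"
      then obtain i where "i \<in> J" "f y i = a i \<or> f y i = b i" unfolding J_def by blast
      then show "\<exists>i<d. (-1::real) < 1 \<and> (y i = -1 \<or> y i = 1)"
        using ee'[of i] f_low f_high by (intro exI[of _ "e' i"]) auto
    qed
  qed
  then show thesis using hom that by blast
qed

lemma ball_cbox_homeomorphism:
  assumes ab: "\<And>i. i < n \<Longrightarrow> a i \<le> b i" and d: "d = card {i. i < n \<and> a i < b i}"
  obtains f g where "homeomorphism (ball_set d) (cbox_set n a b) f g"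
    "f ` sphere_set d = cbox_frontier n a b"
proof -
  obtain f g where fg: "homeomorphism (ball_set d) (cbox_set d (\<lambda>_. -1) (\<lambda>_. 1)) f g"
    "f ` sphere_set d = cbox_frontier d (\<lambda>_. -1) (\<lambda>_. 1)"
    by (rule ball_cube_homeomorphism)
  obtain f' g' where fg': "homeomorphism (cbox_set d (\<lambda>_. -1) (\<lambda>_. 1)) (cbox_set n a b) f' g'"
    "f' ` cbox_frontier d (\<lambda>_. -1) (\<lambda>_. 1) = cbox_frontier n a b"
    using cube_cbox_homeomorphism[OF ab d] by blast
  have "(f' \<circ> f) ` sphere_set d = cbox_frontier n a b"
    using fg(2) fg'(2) unfolding image_comp[symmetric] by simp
  then show thesis using that homeomorphism_compose[OF fg(1) fg'(1)] by blast
qed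

section \<open>Dyadic exhaustion of open subsets of a cube\<close>

abbreviation cube :: "nat \<Rightarrow> (nat \<Rightarrow> real) set" where
  "cube n \<equiv> cbox_set n (\<lambda>_. -1) (\<lambda>_. 1)"

abbreviation cube_frontier :: "nat \<Rightarrow> (nat \<Rightarrow> real) set" where
  "cube_frontier n \<equiv> cbox_frontier n (\<lambda>_. -1) (\<lambda>_. 1)"

definition dyadic_down :: "nat \<Rightarrow> (nat \<Rightarrow> real) \<Rightarrow> nat \<Rightarrow> real" where
  "dyadic_down k x i = of_int \<lfloor>2 ^ k * x i\<rfloor> / 2 ^ k"

definition dyadic_up :: "nat \<Rightarrow> (nat \<Rightarrow> real) \<Rightarrow> nat \<Rightarrow> real" where
  "dyadic_up k x i = of_int \<lceil>2 ^ k * x i\<rceil> / 2 ^ k"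

text \<open>
  The smallest closed face containing \<open>x\<close> in the grid of mesh \<open>2\<^sup>-\<^sup>k\<close>. Naming faces by the points they
  carry avoids any indexing of the grid: inclusion of faces becomes membership, two points lie in the
  same open face if their faces agree, and the frontier of a face consists of the points that carry
  a smaller face.
\<close>

definition dyadic_face :: "nat \<Rightarrow> nat \<Rightarrow> (nat \<Rightarrow> real) \<Rightarrow> (nat \<Rightarrow> real) set" where
  "dyadic_face n k x = cbox_set n (dyadic_down k x) (dyadic_up k x)"

lemma mem_dyadic_face:
  "y \<in> dyadic_face n k x \<longleftrightarrow> (\<forall>i\<ge>n. y i = 0) \<and>
     (\<forall>i<n. of_int \<lfloor>2 ^ k * x i\<rfloor> \<le> 2 ^ k * y i \<and> 2 ^ k * y i \<le> of_int \<lceil>2 ^ k * x i\<rceil>)"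
  unfolding dyadic_face_def cbox_set_def dyadic_down_def dyadic_up_def
  by (auto simp: field_simps)

lemma dyadic_down_le_up: "dyadic_down k x i \<le> dyadic_up k x i"
  unfolding dyadic_down_def dyadic_up_def by (intro divide_right_mono) (linarith, simp)

lemma dyadic_face_refl: "\<forall>i\<ge>n. x i = 0 \<Longrightarrow> x \<in> dyadic_face n k x"
  unfolding mem_dyadic_face by simp

lemma dyadic_face_mono:
  assumes "y \<in> dyadic_face n k x"
  shows "dyadic_face n k y \<subseteq> dyadic_face n k x"
proof
  fix z assume z: "z \<in> dyadic_face n k y"
  have "of_int \<lfloor>2 ^ k * x i\<rfloor> \<le> 2 ^ k * z i \<and> 2 ^ k * z i \<le> of_int \<lceil>2 ^ k * x i\<rceil>" if "i < n" for i
  proof -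
    have "\<lfloor>2 ^ k * x i\<rfloor> \<le> \<lfloor>2 ^ k * y i\<rfloor>" "\<lceil>2 ^ k * y i\<rceil> \<le> \<lceil>2 ^ k * x i\<rceil>"
      using assms that unfolding mem_dyadic_face by (simp_all add: le_floor_iff ceiling_le_iff)
    then have "(of_int \<lfloor>2 ^ k * x i\<rfloor> :: real) \<le> of_int \<lfloor>2 ^ k * y i\<rfloor>"
      "(of_int \<lceil>2 ^ k * y i\<rceil> :: real) \<le> of_int \<lceil>2 ^ k * x i\<rceil>" by simp_all
    then show ?thesis using z that unfolding mem_dyadic_face by force
  qed
  then show "z \<in> dyadic_face n k x" using z unfolding mem_dyadic_face by blast
qed

lemma dyadic_face_refine: "dyadic_face n (Suc k) x \<subseteq> dyadic_face n k x"
proof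
  fix z assume z: "z \<in> dyadic_face n (Suc k) x"
  have "of_int \<lfloor>2 ^ k * x i\<rfloor> \<le> 2 ^ k * z i \<and> 2 ^ k * z i \<le> of_int \<lceil>2 ^ k * x i\<rceil>" if "i < n" for i
  proof -
    have "2 * \<lfloor>2 ^ k * x i\<rfloor> \<le> \<lfloor>2 ^ Suc k * x i\<rfloor>" "\<lceil>2 ^ Suc k * x i\<rceil> \<le> 2 * \<lceil>2 ^ k * x i\<rceil>"
      by (simp_all add: le_floor_iff ceiling_le_iff)
    then have "2 * (of_int \<lfloor>2 ^ k * x i\<rfloor> :: real) \<le> of_int \<lfloor>2 ^ Suc k * x i\<rfloor>"
      "(of_int \<lceil>2 ^ Suc k * x i\<rceil> :: real) \<le> 2 * of_int \<lceil>2 ^ k * x i\<rceil>" by linarith+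
    moreover have "of_int \<lfloor>2 ^ Suc k * x i\<rfloor> \<le> 2 * (2 ^ k * z i)"
      "2 * (2 ^ k * z i) \<le> of_int \<lceil>2 ^ Suc k * x i\<rceil>"
      using z that unfolding mem_dyadic_face by (auto simp: mult.assoc)
    ultimately show ?thesis by linarith
  qed
  then show "z \<in> dyadic_face n k x" using z unfolding mem_dyadic_face by blast
qed

lemma dyadic_bounds_in_cube:
  assumes "x \<in> cube n" "i < n"
  shows "\<lfloor>2 ^ k * x i\<rfloor> \<in> {-(2 ^ k)..2 ^ k}" "\<lceil>2 ^ k * x i\<rceil> \<in> {-(2 ^ k)..2 ^ k}"
proof -
  have "-1 \<le> x i" "x i \<le> 1" using assms unfolding cbox_set_def by auto
  then have "-(2 ^ k) \<le> 2 ^ k * x i" "2 ^ k * x i \<le> 2 ^ k"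
    using mult_left_mono[of "-1" "x i" "2 ^ k"] mult_left_mono[of "x i" 1 "2 ^ k"] by auto
  then have "of_int (-(2 ^ k)) \<le> 2 ^ k * x i" "2 ^ k * x i \<le> of_int (2 ^ k)" by auto
  then show "\<lfloor>2 ^ k * x i\<rfloor> \<in> {-(2 ^ k)..2 ^ k}" "\<lceil>2 ^ k * x i\<rceil> \<in> {-(2 ^ k)..2 ^ k}"
    by (auto simp only: atLeastAtMost_iff le_floor_iff floor_le_iff ceiling_le_iff le_ceiling_iff)
qed

lemma dyadic_face_subset_cube:
  assumes "x \<in> cube n"
  shows "dyadic_face n k x \<subseteq> cube n"
proof
  fix y assume y: "y \<in> dyadic_face n k x"
  have "-1 \<le> y i \<and> y i \<le> 1" if "i < n" for i
  proof -
    have "-(2 ^ k) \<le> \<lfloor>2 ^ k * x i\<rfloor>" "\<lceil>2 ^ k * x i\<rceil> \<le> 2 ^ k"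
      using dyadic_bounds_in_cube[OF assms that, of k] by auto
    then have 1: "(of_int (-(2 ^ k)) :: real) \<le> of_int \<lfloor>2 ^ k * x i\<rfloor>"
      "(of_int \<lceil>2 ^ k * x i\<rceil> :: real) \<le> of_int (2 ^ k)"
      unfolding of_int_le_iff .
    have 2: "of_int \<lfloor>2 ^ k * x i\<rfloor> \<le> 2 ^ k * y i" "2 ^ k * y i \<le> of_int \<lceil>2 ^ k * x i\<rceil>"
      using y that unfolding mem_dyadic_face by blast+
    have "2 ^ k * -1 \<le> 2 ^ k * y i" "2 ^ k * y i \<le> 2 ^ k * 1"
      using order_trans[OF 1(1) 2(1)] order_trans[OF 2(2) 1(2)] by simp_all
    then show ?thesis
      using mult_le_cancel_left_pos[of "2 ^ k" "-1" "y i"] mult_le_cancel_left_pos[of "2 ^ k" "y i" 1] by simp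
  qed
  then show "y \<in> cube n" using y unfolding mem_dyadic_face cbox_set_def by auto
qed

lemma finite_dyadic_faces: "finite (dyadic_face n k ` cube n)"
proof -
  let ?I = "PiE {..<n} (\<lambda>_. {-(2 ^ k)..2 ^ k :: int})"
  let ?f = "\<lambda>(p, q). {y. (\<forall>i\<ge>n. y i = 0) \<and>
     (\<forall>i<n. of_int (p i) \<le> 2 ^ k * y i \<and> 2 ^ k * y i \<le> of_int (q i))}"
  have "dyadic_face n k x \<in> ?f ` (?I \<times> ?I)" if x: "x \<in> cube n" for x
  proof (rule image_eqI)
    show "(restrict (\<lambda>i. \<lfloor>2 ^ k * x i\<rfloor>) {..<n}, restrict (\<lambda>i. \<lceil>2 ^ k * x i\<rceil>) {..<n}) \<in> ?I \<times> ?I"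
      using dyadic_bounds_in_cube[OF x] by (simp add: PiE_iff)
  qed (auto simp: mem_dyadic_face)
  then have "dyadic_face n k ` cube n \<subseteq> ?f ` (?I \<times> ?I)" by blast
  then show ?thesis
    by (rule finite_subset) (intro finite_imageI finite_cartesian_product finite_PiE, auto)
qed

lemma closed_cbox_frontier: "closed (cbox_frontier n a b)"
proof -
  have "cbox_frontier n a b = (\<Union>i\<in>{i. i < n \<and> a i < b i}. cbox_set n a b \<inter> ({y. y i = a i} \<union> {y. y i = b i}))"
    unfolding cbox_frontier_def by auto
  moreover have "closed {y::nat \<Rightarrow> real. y i = c}" for i c
    by (rule closed_Collect_eq[OF continuous_on_coordinate continuous_on_const])
  ultimately show ?thesis
    by (simp only:) (intro closed_UN closed_Int closed_Un closed_cbox_set ballI, auto)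
qed

lemma frontier_coordinate_unique:
  assumes "x \<in> dyadic_face n k y" "i < n" "2 ^ k * y i = of_int m"
  shows "x i = y i"
proof -
  have "of_int \<lfloor>2 ^ k * y i\<rfloor> \<le> 2 ^ k * x i" "2 ^ k * x i \<le> of_int \<lceil>2 ^ k * y i\<rceil>"
    using assms(1,2) unfolding mem_dyadic_face by blast+
  then have "2 ^ k * x i = 2 ^ k * y i"
    unfolding assms(3) by simp
  then show ?thesis by simp
qed

text \<open>
  A point of a closed face is on its frontier if and only if some nondegenerate coordinate has become
  a grid value, and then that coordinate is constant on the face carried by the point.
\<close>

lemma dyadic_face_frontier:
  assumes x: "\<forall>i\<ge>n. x i = 0"
  shows "cbox_frontier n (dyadic_down k x) (dyadic_up k x) =
    {y \<in> dyadic_face n k x. dyadic_face n k y \<noteq> dyadic_face n k x}"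
proof -
  have "(\<exists>i<n. dyadic_down k x i < dyadic_up k x i \<and> (y i = dyadic_down k x i \<or> y i = dyadic_up k x i))
      \<longleftrightarrow> dyadic_face n k y \<noteq> dyadic_face n k x" if y: "y \<in> dyadic_face n k x" for y
  proof
    assume "\<exists>i<n. dyadic_down k x i < dyadic_up k x i \<and> (y i = dyadic_down k x i \<or> y i = dyadic_up k x i)"
    then obtain i where i: "i < n" "dyadic_down k x i < dyadic_up k x i"
      and yi: "y i = dyadic_down k x i \<or> y i = dyadic_up k x i" by blast
    then obtain m where m: "2 ^ k * y i = of_int m"
      unfolding dyadic_down_def dyadic_up_def by auto
    show "dyadic_face n k y \<noteq> dyadic_face n k x"
    proof
      assume "dyadic_face n k y = dyadic_face n k x"
      then have "x i = y i"
        using dyadic_face_refl[OF x, of k] frontier_coordinate_unique[of x n k y i m] i(1) m by simp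
      then have "dyadic_down k x i = dyadic_up k x i"
        using m unfolding dyadic_down_def dyadic_up_def by simp
      then show False using i(2) by simp
    qed
  next
    assume ne: "dyadic_face n k y \<noteq> dyadic_face n k x"
    have "\<exists>i<n. \<lfloor>2 ^ k * y i\<rfloor> \<noteq> \<lfloor>2 ^ k * x i\<rfloor> \<or> \<lceil>2 ^ k * y i\<rceil> \<noteq> \<lceil>2 ^ k * x i\<rceil>"
    proof (rule ccontr)
      assume "\<not> ?thesis"
      then have "\<lfloor>2 ^ k * y i\<rfloor> = \<lfloor>2 ^ k * x i\<rfloor>" "\<lceil>2 ^ k * y i\<rceil> = \<lceil>2 ^ k * x i\<rceil>"
        if "i < n" for i using that by blast+
      then have "dyadic_face n k y = dyadic_face n k x"
        by (simp add: set_eq_iff mem_dyadic_face)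
      with ne show False ..
    qed
    then obtain i where i: "i < n" and d: "\<lfloor>2 ^ k * y i\<rfloor> \<noteq> \<lfloor>2 ^ k * x i\<rfloor> \<or> \<lceil>2 ^ k * y i\<rceil> \<noteq> \<lceil>2 ^ k * x i\<rceil>"
      by blast
    have b: "of_int \<lfloor>2 ^ k * x i\<rfloor> \<le> 2 ^ k * y i" "2 ^ k * y i \<le> of_int \<lceil>2 ^ k * x i\<rceil>"
      using y i unfolding mem_dyadic_face by blast+
    have c: "\<lceil>2 ^ k * x i\<rceil> \<le> \<lfloor>2 ^ k * x i\<rfloor> + 1" by linarith
    have "\<lfloor>2 ^ k * x i\<rfloor> < \<lceil>2 ^ k * x i\<rceil>"
    proof (rule ccontr)
      assume "\<not> ?thesis"
      then have "\<lfloor>2 ^ k * x i\<rfloor> = \<lceil>2 ^ k * x i\<rceil>" by linarith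
      then have "2 ^ k * y i = of_int \<lfloor>2 ^ k * x i\<rfloor>" using b by linarith
      then show False using d \<open>\<lfloor>2 ^ k * x i\<rfloor> = \<lceil>2 ^ k * x i\<rceil>\<close> by simp
    qed
    moreover have "2 ^ k * y i = of_int \<lfloor>2 ^ k * x i\<rfloor> \<or> 2 ^ k * y i = of_int \<lceil>2 ^ k * x i\<rceil>"
    proof (rule ccontr)
      assume "\<not> ?thesis"
      then have "of_int \<lfloor>2 ^ k * x i\<rfloor> < 2 ^ k * y i" "2 ^ k * y i < of_int \<lceil>2 ^ k * x i\<rceil>"
        using b by linarith+
      then have "\<lfloor>2 ^ k * y i\<rfloor> = \<lfloor>2 ^ k * x i\<rfloor>" "\<lceil>2 ^ k * y i\<rceil> = \<lceil>2 ^ k * x i\<rceil>" using c by linarith+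
      then show False using d by simp
    qed
    ultimately have "dyadic_down k x i < dyadic_up k x i \<and>
        (y i = dyadic_down k x i \<or> y i = dyadic_up k x i)"
      unfolding dyadic_down_def dyadic_up_def by (auto simp: divide_strict_right_mono eq_divide_eq mult.commute)
    then show "\<exists>i<n. dyadic_down k x i < dyadic_up k x i \<and> (y i = dyadic_down k x i \<or> y i = dyadic_up k x i)"
      using i by blast
  qed
  then show ?thesis unfolding cbox_frontier_def dyadic_face_def[symmetric] by blast
qed

text \<open>
  The sides of the cube lie in grid hyperplanes, so an open face does not meet the frontier of the
  cube unless it is contained in it.
\<close>

lemma same_face_interior:
  assumes "x \<in> cube n - cube_frontier n" "y \<in> dyadic_face n k x" "dyadic_face n k y = dyadic_face n k x"
  shows "y \<in> cube n - cube_frontier n"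
proof -
  have xC: "x \<in> cube n" and x0: "\<forall>i\<ge>n. x i = 0" using assms(1) unfolding cbox_set_def by auto
  have "y \<notin> cube_frontier n"
  proof
    assume "y \<in> cube_frontier n"
    then obtain i where i: "i < n" "y i = -1 \<or> y i = 1" unfolding cbox_frontier_def by auto
    then have "2 ^ k * y i = of_int (if y i = 1 then 2 ^ k else -(2 ^ k))" by auto
    moreover have "x \<in> dyadic_face n k y" using dyadic_face_refl[OF x0] assms(3) by simp
    ultimately have "x i = y i" using frontier_coordinate_unique i(1) by blast
    then have "x \<in> cube_frontier n" using xC i unfolding cbox_frontier_def by auto
    then show False using assms(1) by blast
  qed
  then show ?thesis using dyadic_face_subset_cube[OF xC] assms(2) by blast
qed

text \<open>
  Near \<open>y\<close> all faces of a sufficiently fine grid stay inside \<open>W\<close>. This local statement replaces local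
  finiteness of the decomposition: it makes each point of \<open>W\<close> interior to some stage.
\<close>

lemma small_dyadic_faces:
  assumes W: "openin (top_of_set (cube n)) W" and y: "y \<in> W"
  obtains k N where "openin (top_of_set W) N" "y \<in> N" "\<And>z. z \<in> N \<Longrightarrow> dyadic_face n k z \<subseteq> W"
proof -
  obtain T where T: "open T" "W = cube n \<inter> T"
    using W by (auto simp: openin_open)
  have "openin (product_topology (\<lambda>_::nat. euclideanreal) UNIV) T"
    using T(1) by (simp add: euclidean_product_topology)
  then obtain X where X: "y \<in> (\<Pi>\<^sub>E i\<in>UNIV. X i)" "\<And>i. openin euclideanreal (X i)"
    "(\<Pi>\<^sub>E i\<in>UNIV. X i) \<subseteq> T"
    using product_topology_open_contains_basis[of "\<lambda>_. euclideanreal" UNIV T y] y T(2) by blast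
  have yX: "y i \<in> X i" for i using X(1) by (auto simp: PiE_iff)
  have lim: "(\<lambda>k. 2 * (1 / 2 ^ k :: real)) \<longlonglongrightarrow> 0"
  proof -
    have "(\<lambda>k. (1 / 2 :: real) ^ k) \<longlonglongrightarrow> 0" by (rule LIMSEQ_realpow_zero) simp_all
    then have "(\<lambda>k. 1 / (2 :: real) ^ k) \<longlonglongrightarrow> 0" unfolding power_one_over .
    then show ?thesis by (rule tendsto_mult_right_zero)
  qed
  \<comment> \<open>Two mesh widths: one from \<open>y\<close> to the base point of the face, one across the face.\<close>
  have "\<forall>\<^sub>F k in sequentially. ball (y i) (2 * (1 / 2 ^ k)) \<subseteq> X i" for i
  proof -
    have "open (X i)" using X(2)[of i] by simp
    then obtain e where e: "e > 0" "ball (y i) e \<subseteq> X i" using yX[of i] open_contains_ball by blast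
    have "ball (y i) r \<subseteq> X i" if "r < e" for r
      using subset_ball[of r e "y i"] that e(2) by simp
    then show ?thesis
      by (rule eventually_mono[OF order_tendstoD(2)[OF lim e(1)]])
  qed
  then have "\<forall>\<^sub>F k in sequentially. \<forall>i\<in>{..<n}. ball (y i) (2 * (1 / 2 ^ k)) \<subseteq> X i"
    by (intro eventually_ball_finite) auto
  then obtain k where k: "\<And>i. i < n \<Longrightarrow> ball (y i) (2 * (1 / 2 ^ k)) \<subseteq> X i"
    by (auto simp: eventually_sequentially)
  define O' where "O' = (\<Inter>i\<in>{..<n}. {z::nat \<Rightarrow> real. \<bar>z i - y i\<bar> < 1 / 2 ^ k})"
  have "open {z::nat \<Rightarrow> real. \<bar>z i - y i\<bar> < 1 / 2 ^ k}" for i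
    by (intro open_Collect_less continuous_on_rabs continuous_on_diff continuous_on_const continuous_on_coordinate)
  then have "open O'" unfolding O'_def by (intro open_INT) auto
  show thesis
  proof (rule that)
    show "openin (top_of_set W) (W \<inter> O')" using \<open>open O'\<close> by auto
    show "y \<in> W \<inter> O'" using y unfolding O'_def by auto
    fix z assume z: "z \<in> W \<inter> O'"
    show "dyadic_face n k z \<subseteq> W"
    proof
      fix w assume w: "w \<in> dyadic_face n k z"
      have "w \<in> cube n" using dyadic_face_subset_cube w z T(2) by blast
      have "w i \<in> X i" for i
      proof (cases "i < n")
        case True
        have "of_int \<lfloor>2 ^ k * z i\<rfloor> \<le> 2 ^ k * w i" "2 ^ k * w i \<le> of_int \<lceil>2 ^ k * z i\<rceil>"
          using w True unfolding mem_dyadic_face by blast+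
        then have "2 ^ k * w i - 2 ^ k * z i \<le> 1" "2 ^ k * z i - 2 ^ k * w i \<le> 1" by linarith+
        then have "w i - z i \<le> 1 / 2 ^ k" "z i - w i \<le> 1 / 2 ^ k"
          by (simp_all add: field_simps)
        moreover have "\<bar>z i - y i\<bar> < 1 / 2 ^ k" using z True unfolding O'_def by auto
        ultimately have "dist (y i) (w i) < 2 * (1 / 2 ^ k)" unfolding dist_real_def by linarith
        then show ?thesis using k[OF True] by auto
      next
        case False
        then have "w i = y i" using \<open>w \<in> cube n\<close> y T(2) unfolding cbox_set_def by auto
        then show ?thesis using yX by simp
      qed
      then have "w \<in> T" using X(3) by (auto simp: PiE_iff)
      then show "w \<in> W" using \<open>w \<in> cube n\<close> T(2) by blast
    qed
  qed
qed

text \<open>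
  Subcomplexes of the grid relative to the frontier of the cube: with a point, \<open>Q\<close> contains the part of
  its closed face that is interior to the cube. No cell structure is imposed on the frontier.
\<close>

definition face_closed :: "nat \<Rightarrow> nat \<Rightarrow> (nat \<Rightarrow> real) set \<Rightarrow> bool" where
  "face_closed n k Q \<longleftrightarrow> Q \<subseteq> cube n - cube_frontier n \<and>
     (\<forall>x\<in>Q. dyadic_face n k x - cube_frontier n \<subseteq> Q)"

text \<open>
  Since the grid has finitely many faces in the cube, \<open>Q\<close> is a finite union of closed faces up to the
  frontier.
\<close>

lemma closedin_face_closed:
  assumes Q: "face_closed n k Q" and QW: "\<And>x. x \<in> Q \<Longrightarrow> dyadic_face n k x \<subseteq> W"
  shows "closedin (top_of_set W) ((W \<inter> cube_frontier n) \<union> Q)"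
proof -
  have QC: "Q \<subseteq> cube n" using Q unfolding face_closed_def by blast
  have refl: "x \<in> dyadic_face n k x" if "x \<in> Q" for x
    using QC that by (intro dyadic_face_refl) (auto simp: cbox_set_def)
  have eq: "(W \<inter> cube_frontier n) \<union> Q = W \<inter> (cube_frontier n \<union> \<Union>(dyadic_face n k ` Q))"
    using Q QW refl unfolding face_closed_def by blast
  have "finite (dyadic_face n k ` Q)"
    using finite_dyadic_faces finite_subset image_mono[OF QC] by metis
  then have "closed (cube_frontier n \<union> \<Union>(dyadic_face n k ` Q))"
    by (intro closed_Un closed_cbox_frontier closed_Union) (auto simp: dyadic_face_def closed_cbox_set)
  then show ?thesis unfolding eq by (rule closedin_closed_Int)
qed

text \<open>
  From one subcomplex to a larger one by attaching one face at a time. A missing face that is minimal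
  with respect to inclusion can be attached next: its proper faces are already present, and its open
  face is disjoint from what is present. The relation \<open>R\<close> abstracts ``obtainable by attaching cells''.
\<close>

lemma face_closed_reachable:
  fixes R :: "(nat \<Rightarrow> real) set \<Rightarrow> (nat \<Rightarrow> real) set \<Rightarrow> bool"
  assumes refl: "\<And>P. P \<subseteq> W \<Longrightarrow> R P P"
    and trans: "\<And>P P' P''. R P P' \<Longrightarrow> R P' P'' \<Longrightarrow> R P P''"
    and step: "\<And>P x. x \<in> cube n - cube_frontier n \<Longrightarrow> dyadic_face n k x \<subseteq> W \<Longrightarrow>
      W \<inter> cube_frontier n \<subseteq> P \<Longrightarrow> closedin (top_of_set W) P \<Longrightarrow>
      cbox_frontier n (dyadic_down k x) (dyadic_up k x) \<subseteq> P \<Longrightarrow>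
      (dyadic_face n k x - cbox_frontier n (dyadic_down k x) (dyadic_up k x)) \<inter> P = {} \<Longrightarrow>
      R P (P \<union> dyadic_face n k x)"
    and Q: "face_closed n k Q" "face_closed n k Q'" "Q \<subseteq> Q'"
    and Q'W: "\<And>x. x \<in> Q' \<Longrightarrow> dyadic_face n k x \<subseteq> W"
  shows "R ((W \<inter> cube_frontier n) \<union> Q) ((W \<inter> cube_frontier n) \<union> Q')"
  using Q(1,3)
proof (induction "card (dyadic_face n k ` (Q' - Q))" arbitrary: Q rule: less_induct)
  case less
  have Q'C: "Q' \<subseteq> cube n - cube_frontier n" using Q(2) unfolding face_closed_def by blast
  have refl': "x \<in> dyadic_face n k x" if "x \<in> Q'" for x
    using Q'C that by (intro dyadic_face_refl) (auto simp: cbox_set_def)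
  have fin: "finite (dyadic_face n k ` (Q' - Q))"
    using Q'C by (intro finite_subset[OF _ finite_dyadic_faces[of n k]]) blast
  show ?case
  proof (cases "Q' = Q")
    case True
    have "(W \<inter> cube_frontier n) \<union> Q' \<subseteq> W" using Q'W refl' by blast
    then show ?thesis using refl True by simp
  next
    case False
    then have "dyadic_face n k ` (Q' - Q) \<noteq> {}" using less.prems(2) by blast
    from finite_has_minimal[OF fin this]
    obtain x where x: "x \<in> Q'" "x \<notin> Q"
      and min: "\<And>y. y \<in> Q' \<Longrightarrow> y \<notin> Q \<Longrightarrow> dyadic_face n k y \<subseteq> dyadic_face n k x \<Longrightarrow>
        dyadic_face n k y = dyadic_face n k x"
      by auto
    let ?F = "dyadic_face n k x"
    let ?L = "cbox_frontier n (dyadic_down k x) (dyadic_up k x)"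
    let ?P = "(W \<inter> cube_frontier n) \<union> Q"
    have xI: "x \<in> cube n - cube_frontier n" using x Q'C by blast
    have L: "?L = {y \<in> ?F. dyadic_face n k y \<noteq> ?F}"
      using xI by (intro dyadic_face_frontier) (auto simp: cbox_set_def)
    have FW: "?F \<subseteq> W" using Q'W x by blast
    have FQ': "?F - cube_frontier n \<subseteq> Q'" using Q(2) x unfolding face_closed_def by blast
    have LP: "?L \<subseteq> ?P"
    proof
      fix y assume y: "y \<in> ?L"
      show "y \<in> ?P"
      proof (rule ccontr)
        assume "y \<notin> ?P"
        then have "y \<in> Q'" "y \<notin> Q" using y L FW FQ' by blast+
        then show False using min[of y] y L dyadic_face_mono[of y n k x] by blast
      qed
    qed
    have disj: "(?F - ?L) \<inter> ?P = {}"
    proof -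
      have False if y: "y \<in> ?F" "y \<notin> ?L" "y \<in> ?P" for y
      proof -
        have same: "dyadic_face n k y = ?F" using y L by blast
        then have yI: "y \<in> cube n - cube_frontier n" using same_face_interior[OF xI y(1)] by blast
        then have "y \<in> Q" using y(3) by blast
        then have "?F - cube_frontier n \<subseteq> Q" using less.prems(1) same unfolding face_closed_def by metis
        then show False using x xI refl' by blast
      qed
      then show ?thesis by blast
    qed
    have QW: "dyadic_face n k y \<subseteq> W" if "y \<in> Q" for y using Q'W less.prems(2) that by blast
    have R1: "R ?P (?P \<union> ?F)"
      using xI FW LP disj closedin_face_closed[OF less.prems(1) QW] by (intro step) auto
    define Q1 where "Q1 = Q \<union> (?F - cube_frontier n)"
    have P1: "?P \<union> ?F = (W \<inter> cube_frontier n) \<union> Q1" unfolding Q1_def using FW by blast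
    have Q1: "face_closed n k Q1"
      unfolding face_closed_def
    proof (intro conjI ballI)
      show "Q1 \<subseteq> cube n - cube_frontier n"
        using less.prems(1) FQ' Q'C unfolding Q1_def face_closed_def by blast
      fix y assume "y \<in> Q1"
      then show "dyadic_face n k y - cube_frontier n \<subseteq> Q1"
        using less.prems(1) dyadic_face_mono[of y n k x] unfolding Q1_def face_closed_def by blast
    qed
    have "dyadic_face n k ` (Q' - Q1) \<subset> dyadic_face n k ` (Q' - Q)"
    proof (rule psubsetI)
      show "dyadic_face n k ` (Q' - Q1) \<subseteq> dyadic_face n k ` (Q' - Q)" unfolding Q1_def by blast
      have "?F \<notin> dyadic_face n k ` (Q' - Q1)"
      proof
        assume "?F \<in> dyadic_face n k ` (Q' - Q1)"
        then obtain y where "y \<in> Q'" "y \<notin> Q1" "dyadic_face n k y = ?F" by auto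
        then show False using refl'[of y] Q'C unfolding Q1_def by blast
      qed
      then show "dyadic_face n k ` (Q' - Q1) \<noteq> dyadic_face n k ` (Q' - Q)" using x by blast
    qed
    then have "card (dyadic_face n k ` (Q' - Q1)) < card (dyadic_face n k ` (Q' - Q))"
      using fin by (intro psubset_card_mono)
    moreover have "Q1 \<subseteq> Q'" unfolding Q1_def using less.prems(2) FQ' by blast
    ultimately have "R ((W \<inter> cube_frontier n) \<union> Q1) ((W \<inter> cube_frontier n) \<union> Q')"
      using less.hyps Q1 by blast
    then show ?thesis using trans R1 unfolding P1 by blast
  qed
qed

text \<open>
  An open subset \<open>W\<close> of the cube is built from \<open>W \<inter> \<partial>\<close> by countably many faces: stage \<open>k + 1\<close> adds
  the faces of level \<open>k\<close> contained in \<open>W\<close>. It is also a subcomplex of the grid of level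
  \<open>k + 1\<close>, because grids refine each other, so the passage from one stage to the next is covered by
  the finite case.
\<close>

lemma dyadic_exhaustion:
  fixes R :: "(nat \<Rightarrow> real) set \<Rightarrow> (nat \<Rightarrow> real) set \<Rightarrow> bool"
  assumes W: "openin (top_of_set (cube n)) W"
    and refl: "\<And>P. P \<subseteq> W \<Longrightarrow> R P P"
    and trans: "\<And>P P' P''. R P P' \<Longrightarrow> R P' P'' \<Longrightarrow> R P P''"
    and step: "\<And>P x k. x \<in> cube n - cube_frontier n \<Longrightarrow> dyadic_face n k x \<subseteq> W \<Longrightarrow>
      W \<inter> cube_frontier n \<subseteq> P \<Longrightarrow> closedin (top_of_set W) P \<Longrightarrow>
      cbox_frontier n (dyadic_down k x) (dyadic_up k x) \<subseteq> P \<Longrightarrow>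
      (dyadic_face n k x - cbox_frontier n (dyadic_down k x) (dyadic_up k x)) \<inter> P = {} \<Longrightarrow>
      R P (P \<union> dyadic_face n k x)"
  obtains P where "P 0 = W \<inter> cube_frontier n" "\<And>k. P k \<subseteq> W" "\<And>k::nat. R (P k) (P (Suc k))"
    "\<And>y. y \<in> W \<Longrightarrow> \<exists>k N. openin (top_of_set W) N \<and> y \<in> N \<and> N \<subseteq> P k"
proof -
  let ?B = "cube_frontier n"
  have WC: "W \<subseteq> cube n" using W openin_imp_subset by blast
  define Q where "Q k = {x \<in> cube n - ?B. dyadic_face n k x \<subseteq> W}" for k
  have zero: "\<forall>i\<ge>n. x i = 0" if "x \<in> cube n" for x using that unfolding cbox_set_def by blast
  have QW: "Q k \<subseteq> W" for k unfolding Q_def using dyadic_face_refl[OF zero] by blast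
  have closed': "face_closed n l (Q k)" if "\<And>x. dyadic_face n l x \<subseteq> dyadic_face n k x" for l k
    unfolding face_closed_def
  proof (intro conjI ballI subsetI)
    fix x y assume x: "x \<in> Q k" and y: "y \<in> dyadic_face n l x - ?B"
    then have "y \<in> dyadic_face n k x" using that by blast
    then show "y \<in> Q k"
      using x y dyadic_face_mono[of y n k x] dyadic_face_subset_cube[of x n k] unfolding Q_def by blast
  qed (auto simp: Q_def)
  have reach: "R ((W \<inter> ?B) \<union> Q0) ((W \<inter> ?B) \<union> Q k)" if "face_closed n k Q0" "Q0 \<subseteq> Q k" for Q0 k
    by (rule face_closed_reachable[OF refl trans step that(1) closed' that(2)]) (auto simp: Q_def)
  define P where "P k = (W \<inter> ?B) \<union> (case k of 0 \<Rightarrow> {} | Suc l \<Rightarrow> Q l)" for k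
  show thesis
  proof (rule that)
    show "P 0 = W \<inter> ?B" unfolding P_def by simp
    show "P k \<subseteq> W" for k unfolding P_def using QW by (auto split: nat.split)
    show "R (P k) (P (Suc k))" for k
    proof (cases k)
      case 0
      then show ?thesis using reach[of 0 "{}"] unfolding P_def face_closed_def by simp
    next
      case (Suc l)
      have "Q l \<subseteq> Q (Suc l)" unfolding Q_def using dyadic_face_refine by blast
      then show ?thesis
        using reach[OF closed'[of "Suc l" l, OF dyadic_face_refine]] unfolding P_def Suc by simp
    qed
    fix y assume "y \<in> W"
    then obtain k N where N: "openin (top_of_set W) N" "y \<in> N" "\<And>z. z \<in> N \<Longrightarrow> dyadic_face n k z \<subseteq> W"
      using small_dyadic_faces[OF W] by metis
    have "N \<subseteq> W" using N(1) openin_imp_subset by blast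
    then have "N \<subseteq> P (Suc k)" using N(3) WC unfolding P_def Q_def by auto
    then show "\<exists>k N. openin (top_of_set W) N \<and> y \<in> N \<and> N \<subseteq> P k" using N by blast
  qed
qed

section \<open>An orbit cell cut down to an open invariant set\<close>

lemma prod_topology_top_of_set:
  assumes "A \<subseteq> K"
  shows "prod_topology X (top_of_set A) = subtopology (prod_topology X (top_of_set K)) (topspace X \<times> A)"
proof -
  have "top_of_set A = subtopology (top_of_set K) A"
    using assms by (simp add: subtopology_subtopology Int_absorb1)
  then show ?thesis using prod_topology_subtopology(2)[of X "top_of_set K" A] by simp
qed

lemma (in group) lcoset_translate:
  assumes "subgroup H G" "g \<in> carrier G" "c \<in> lcosets H"
  shows "g <# c \<in> lcosets H"
proof -
  obtain h where h: "h \<in> carrier G" "c = h <# H" using assms(3) unfolding LCOSETS_def by auto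
  then have "g <# c = (g \<otimes> h) <# H"
    using assms lcos_m_assoc[OF subgroup.subset[OF assms(1)]] by simp
  then show ?thesis using h assms(2) unfolding LCOSETS_def by auto
qed

text \<open>
  The situation for a single cell: \<open>E\<close> arises from \<open>D\<close> by attaching a cube times an orbit, and \<open>V\<close> is an
  open invariant set. As \<open>G\<close> acts transitively on \<open>G/H\<close>, the preimage of \<open>V\<close> in the cell is \<open>G/H\<close> times
  an open subset of the cube, called the window. The part of \<open>E \<inter> V\<close> built from a subset \<open>P\<close> of the
  window is \<open>stage P\<close>.
\<close>

locale open_in_attached_cell =
  fixes G :: "('g, 'm) topgroup_scheme" and H :: "'g set" and Z :: "('g, 'z) gspace"
    and D E V :: "'z set" and n :: nat and \<Psi> :: "'g set \<times> (nat \<Rightarrow> real) \<Rightarrow> 'z"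
  assumes group: "group G" and carrier: "topspace (gtopology G) = carrier G" and H: "subgroup H G"
    and D: "invariant G Z D" and E: "invariant G Z E"
    and att: "attaches G H Z D E (cube n) (cube_frontier n) \<Psi>"
    and V: "openin (space_top Z) V" "invariant G Z V"
begin

abbreviation orbit :: "'g set set" where
  "orbit \<equiv> lcosets\<^bsub>G\<^esub> H"

abbreviation orbit_prod :: "(nat \<Rightarrow> real) set \<Rightarrow> ('g set \<times> (nat \<Rightarrow> real)) topology" where
  "orbit_prod K \<equiv> prod_topology (coset_space G H) (top_of_set K)"

definition window :: "(nat \<Rightarrow> real) set" where
  "window = {y \<in> cube n. \<Psi> (H, y) \<in> V}"

definition stage :: "(nat \<Rightarrow> real) set \<Rightarrow> 'z set" where
  "stage P = (D \<inter> V) \<union> \<Psi> ` (orbit \<times> P)"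

lemmas att_props = attachesD[OF att]

lemma topspace_orbit: "topspace (coset_space G H) = orbit"
  by (rule topspace_coset_space[OF carrier])

lemma H_in_orbit: "H \<in> orbit"
proof -
  interpret group G by (rule group)
  have "\<one>\<^bsub>G\<^esub> <#\<^bsub>G\<^esub> H = H" using lcos_mult_one[OF subgroup.subset[OF H]] .
  then show ?thesis unfolding LCOSETS_def by force
qed

lemma window_iff:
  assumes c: "c \<in> orbit" and y: "y \<in> cube n"
  shows "\<Psi> (c, y) \<in> V \<longleftrightarrow> y \<in> window"
proof -
  interpret group G by (rule group)
  obtain g where g: "g \<in> carrier G" "c = g <#\<^bsub>G\<^esub> H" using c unfolding LCOSETS_def by auto
  have 1: "\<Psi> (c, y) = act Z g (\<Psi> (H, y))"
    using att_props(7)[OF g(1) H_in_orbit y] g(2) by simp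
  have "inv\<^bsub>G\<^esub> g <#\<^bsub>G\<^esub> c = H"
    using g lcos_m_assoc[OF subgroup.subset[OF H]] lcos_mult_one[OF subgroup.subset[OF H]] by simp
  then have 2: "\<Psi> (H, y) = act Z (inv\<^bsub>G\<^esub> g) (\<Psi> (c, y))"
    using att_props(7)[OF inv_closed[OF g(1)] c y] by simp
  have "\<And>g x. g \<in> carrier G \<Longrightarrow> x \<in> V \<Longrightarrow> act Z g x \<in> V"
    using V(2) unfolding invariant_def by blast
  then have "\<Psi> (c, y) \<in> V \<longleftrightarrow> \<Psi> (H, y) \<in> V"
    using 1 2 g(1) inv_closed[OF g(1)] by metis
  then show ?thesis using y unfolding window_def by blast
qed

lemma window_subset: "window \<subseteq> cube n"
  unfolding window_def by blast

lemma openin_window: "openin (top_of_set (cube n)) window"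
proof -
  have "continuous_map (top_of_set (cube n)) (orbit_prod (cube n)) (\<lambda>y. (H, y))"
    using H_in_orbit topspace_orbit by (auto intro!: continuous_map_pairedI)
  then have "continuous_map (top_of_set (cube n)) (space_top Z) (\<lambda>y. \<Psi> (H, y))"
    using continuous_map_compose[OF _ att_props(6)] by (simp add: o_def)
  from openin_continuous_map_preimage[OF this V(1)] show ?thesis
    unfolding window_def by simp
qed

lemma continuous_on_orbit_prod:
  "P \<subseteq> cube n \<Longrightarrow> continuous_map (orbit_prod P) (space_top Z) \<Psi>"
  unfolding prod_topology_top_of_set[of P "cube n"]
  by (rule continuous_map_from_subtopology[OF att_props(6)])

lemma stage_invariant:
  assumes "P \<subseteq> cube n"
  shows "invariant G Z (stage P)"
proof -
  interpret group G by (rule group)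
  have "\<Psi> ` (orbit \<times> P) \<subseteq> points Z"
    using continuous_map_image_subset_topspace[OF continuous_on_orbit_prod[OF assms]]
    by (simp add: topspace_orbit)
  moreover have "act Z g (\<Psi> (c, y)) \<in> \<Psi> ` (orbit \<times> P)"
    if "g \<in> carrier G" "c \<in> orbit" "y \<in> P" for g c y
  proof (rule image_eqI)
    show "act Z g (\<Psi> (c, y)) = \<Psi> (g <#\<^bsub>G\<^esub> c, y)"
      using att_props(7)[OF that(1,2)] that(3) assms by (simp add: subset_iff)
    show "(g <#\<^bsub>G\<^esub> c, y) \<in> orbit \<times> P"
      using lcoset_translate[OF H that(1,2)] that(3) by blast
  qed
  ultimately show ?thesis
    using D V(2) unfolding stage_def invariant_def by auto
qed

lemma stage_subset: "P \<subseteq> window \<Longrightarrow> stage P \<subseteq> E \<inter> V"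
  using window_iff window_subset att_props(2) unfolding stage_def by auto

lemma stage_mono: "P \<subseteq> P' \<Longrightarrow> stage P \<subseteq> stage P'"
  unfolding stage_def by auto

lemma stage_window: "stage window = E \<inter> V"
proof
  show "E \<inter> V \<subseteq> stage window"
    using window_iff att_props(2) unfolding stage_def by auto
qed (use stage_subset in blast)

lemma stage_frontier: "stage (window \<inter> cube_frontier n) = D \<inter> V"
  using window_iff att_props(1,3) window_subset unfolding stage_def by auto

text \<open>
  The final topology passes to open invariant subsets: a set that is open relative to \<open>V\<close> and its
  preimages is open before restriction as well.
\<close>

lemma restricted_final_open:
  assumes S: "S \<subseteq> E \<inter> V" and SD: "openin (subtopology (space_top Z) (D \<inter> V)) (S \<inter> D)"
    and S\<Psi>: "openin (orbit_prod window) {p \<in> orbit \<times> window. \<Psi> p \<in> S}"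
  shows "openin (subtopology (space_top Z) (E \<inter> V)) S"
proof -
  have "openin (subtopology (space_top Z) D) (D \<inter> V)"
    using V(1) by (auto simp: openin_subtopology)
  moreover have "subtopology (space_top Z) (D \<inter> V) = subtopology (subtopology (space_top Z) D) (D \<inter> V)"
    by (simp add: subtopology_subtopology)
  ultimately have 1: "openin (subtopology (space_top Z) D) (S \<inter> D)"
    using SD by (metis openin_trans_full)
  have eq: "{p \<in> orbit \<times> window. \<Psi> p \<in> S} = {p \<in> orbit \<times> cube n. \<Psi> p \<in> S}"
    using S window_iff window_subset by auto
  have "openin (orbit_prod (cube n)) (orbit \<times> window)"
    using openin_window topspace_orbit by (simp add: openin_prod_Times_iff) (metis openin_topspace)
  then have 2: "openin (orbit_prod (cube n)) {p \<in> orbit \<times> cube n. \<Psi> p \<in> S}"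
    using openin_trans_full[OF S\<Psi>[unfolded prod_topology_top_of_set[OF window_subset] topspace_orbit eq]]
    by blast
  have "openin (subtopology (space_top Z) E) S"
    using att_props(8)[OF _ 1 2] S by blast
  from openin_subtopology_trans[OF this, of "E \<inter> V"] show ?thesis
    using S by (simp add: Int_absorb2)
qed

lemma restricted_final_closed:
  assumes S: "S \<subseteq> E \<inter> V" and SD: "closedin (subtopology (space_top Z) (D \<inter> V)) (S \<inter> D)"
    and S\<Psi>: "closedin (orbit_prod window) {p \<in> orbit \<times> window. \<Psi> p \<in> S}"
  shows "closedin (subtopology (space_top Z) (E \<inter> V)) S"
proof -
  have VZ: "V \<subseteq> points Z" using V(2) unfolding invariant_def by blast
  have top: "topspace (subtopology (space_top Z) (D \<inter> V)) = D \<inter> V"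
    "topspace (subtopology (space_top Z) (E \<inter> V)) = E \<inter> V" using VZ by auto
  have DE: "D \<subseteq> E" using att_props(2) by blast
  have "openin (subtopology (space_top Z) (E \<inter> V)) (E \<inter> V - S)"
  proof (rule restricted_final_open)
    have "(E \<inter> V - S) \<inter> D = D \<inter> V - S \<inter> D" using DE by blast
    then show "openin (subtopology (space_top Z) (D \<inter> V)) ((E \<inter> V - S) \<inter> D)"
      using SD unfolding closedin_def top by simp
    have "{p \<in> orbit \<times> window. \<Psi> p \<in> E \<inter> V - S} = orbit \<times> window - {p \<in> orbit \<times> window. \<Psi> p \<in> S}"
      using stage_window unfolding stage_def by blast
    then show "openin (orbit_prod window) {p \<in> orbit \<times> window. \<Psi> p \<in> E \<inter> V - S}"
      using S\<Psi> unfolding closedin_def by (simp add: topspace_orbit)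
  qed blast
  then show ?thesis using S unfolding closedin_def top by simp
qed

text \<open>
  Attaching a face to a stage. The substance is the topology of the new stage, for which it is easier
  to argue with closed sets: if the two parts of \<open>S\<close> are closed in \<open>stage P\<close> and in the face, then its
  preimage in the window is a union of two sets that are closed because \<open>P\<close> and \<open>F\<close> are, and the final
  topology on \<open>E \<inter> V\<close> applies.
\<close>

lemma attaches_face:
  assumes P: "P \<subseteq> window" "closedin (top_of_set window) P" "window \<inter> cube_frontier n \<subseteq> P"
    and F: "F \<subseteq> window" "closed F" and L: "L \<subseteq> F" "L \<subseteq> P" "(F - L) \<inter> P = {}"
  shows "attaches G H Z (stage P) (stage (P \<union> F)) F L \<Psi>"
proof -
  have sub: "P \<subseteq> cube n" "F \<subseteq> cube n" using P(1) F(1) window_subset by blast+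
  have int: "F - L \<subseteq> cube n - cube_frontier n" using sub F(1) P(3) L(3) by blast
  have \<Psi>_eq: "y = y'" if "\<Psi> (c, y) = \<Psi> (c', y')" "c \<in> orbit" "c' \<in> orbit"
      "y \<in> cube n - cube_frontier n" "y' \<in> cube n" for c c' y y'
  proof -
    have "y' \<notin> cube_frontier n"
      using att_props(3)[OF that(3), of y'] att_props(5)[OF that(2), of y] that by auto
    then show ?thesis using inj_onD[OF att_props(4) that(1)] that by auto
  qed
  have notD: "\<Psi> (c, y) \<notin> D" if "c \<in> orbit" "y \<in> cube n - cube_frontier n" for c y
    using att_props(5) that by blast
  have VZ: "V \<subseteq> points Z" using V(2) unfolding invariant_def by blast
  have stZ: "stage P \<subseteq> points Z" "stage (P \<union> F) \<subseteq> points Z"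
    using stage_invariant[of P] stage_invariant[of "P \<union> F"] sub unfolding invariant_def by blast+
  show ?thesis
    unfolding attaches_def
  proof (intro conjI)
    show "L \<subseteq> F" by (rule L(1))
    show "stage (P \<union> F) = stage P \<union> \<Psi> ` (orbit \<times> F)"
      unfolding stage_def by blast
    show "\<Psi> ` (orbit \<times> L) \<subseteq> stage P"
      using L(2) unfolding stage_def by blast
    show "inj_on \<Psi> (orbit \<times> (F - L))"
      by (rule inj_on_subset[OF att_props(4)]) (use int in blast)
    have False if p: "c \<in> orbit" "y \<in> F - L" "\<Psi> (c, y) \<in> stage P" for c y
    proof -
      obtain c' y' where "c' \<in> orbit" "y' \<in> P" "\<Psi> (c, y) = \<Psi> (c', y')"
        using p(3) notD[OF p(1)] p(2) int unfolding stage_def by auto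
      then have "y = y'" using \<Psi>_eq[of c y c' y'] p int sub by blast
      then show False using \<open>y' \<in> P\<close> p(2) L(3) by blast
    qed
    then show "\<Psi> ` (orbit \<times> (F - L)) \<inter> stage P = {}" by blast
    show "continuous_map (orbit_prod F) (space_top Z) \<Psi>"
      by (rule continuous_on_orbit_prod[OF sub(2)])
    show "\<forall>g\<in>carrier G. \<forall>c\<in>orbit. \<forall>y\<in>F. \<Psi> (g <#\<^bsub>G\<^esub> c, y) = act Z g (\<Psi> (c, y))"
      using att_props(7) sub by blast
    show "\<forall>O'\<subseteq>stage (P \<union> F). openin (subtopology (space_top Z) (stage P)) (O' \<inter> stage P) \<longrightarrow>
        openin (orbit_prod F) {p \<in> orbit \<times> F. \<Psi> p \<in> O'} \<longrightarrow>
        openin (subtopology (space_top Z) (stage (P \<union> F))) O'"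
    proof (intro allI impI)
      fix O' assume O': "O' \<subseteq> stage (P \<union> F)"
        and oP: "openin (subtopology (space_top Z) (stage P)) (O' \<inter> stage P)"
        and oF: "openin (orbit_prod F) {p \<in> orbit \<times> F. \<Psi> p \<in> O'}"
      define S where "S = stage (P \<union> F) - O'"
      have PPF: "stage P \<subseteq> stage (P \<union> F)" by (rule stage_mono) blast
      have SEV: "S \<subseteq> E \<inter> V" using stage_subset[of "P \<union> F"] P(1) F(1) unfolding S_def by blast
      have "S \<inter> stage P = topspace (subtopology (space_top Z) (stage P)) - O' \<inter> stage P"
        using PPF stZ unfolding S_def by auto
      then have "closedin (subtopology (space_top Z) (stage P)) (S \<inter> stage P)"
        using oP by (simp add: closedin_diff openin_closedin_eq)
      then obtain T where T: "closedin (space_top Z) T" "S \<inter> stage P = T \<inter> stage P"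
        by (auto simp: closedin_subtopology)
      have DVP: "D \<inter> V \<subseteq> stage P" unfolding stage_def by blast
      have "S \<inter> D = T \<inter> (D \<inter> V)" using T(2) DVP SEV by blast
      then have 1: "closedin (subtopology (space_top Z) (D \<inter> V)) (S \<inter> D)"
        using T(1) by (auto simp: closedin_subtopology)
      \<comment> \<open>A point over the open cell has a unique preimage, so \<open>S\<close> is only met over \<open>P\<close> and \<open>F\<close>.\<close>
      have split: "{p \<in> orbit \<times> window. \<Psi> p \<in> S} =
          ({p \<in> orbit \<times> window. \<Psi> p \<in> T} \<inter> (orbit \<times> P)) \<union> {p \<in> orbit \<times> F. \<Psi> p \<in> S}" (is "?A = ?B \<union> ?C")
      proof (intro subset_antisym subsetI)
        fix p assume p: "p \<in> ?A"
        then obtain c y where cy: "p = (c, y)" "c \<in> orbit" "y \<in> window" "\<Psi> (c, y) \<in> S" by auto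
        show "p \<in> ?B \<union> ?C"
        proof (cases "y \<in> P")
          case True
          then have "\<Psi> (c, y) \<in> S \<inter> stage P" using cy unfolding stage_def by blast
          then show ?thesis using T(2) cy True by auto
        next
          case False
          then have y: "y \<in> cube n - cube_frontier n" using P(3) cy(3) window_subset by blast
          have "\<Psi> (c, y) \<in> stage (P \<union> F)" using cy(4) unfolding S_def by blast
          then obtain c' y' where "c' \<in> orbit" "y' \<in> P \<union> F" "\<Psi> (c, y) = \<Psi> (c', y')"
            using notD[OF cy(2) y] unfolding stage_def by auto
          then have "y = y'" using \<Psi>_eq[of c y c' y'] cy(2) y sub by blast
          then show ?thesis using \<open>y' \<in> P \<union> F\<close> False cy by auto
        qed
      next
        fix p assume "p \<in> ?B \<union> ?C"
        then show "p \<in> ?A"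
        proof
          assume p: "p \<in> ?B"
          then have "\<Psi> p \<in> T \<inter> stage P" unfolding stage_def by blast
          then show ?thesis using T(2) p by blast
        qed (use F(1) in blast)
      qed
      have "closedin (orbit_prod window) {p \<in> orbit \<times> window. \<Psi> p \<in> T}"
        using closedin_continuous_map_preimage[OF continuous_on_orbit_prod[OF window_subset] T(1)]
        by (simp add: topspace_orbit)
      moreover have "closedin (orbit_prod window) (orbit \<times> P)"
        using P(2) topspace_orbit by (simp add: closedin_prod_Times_iff) (metis closedin_topspace)
      ultimately have cB: "closedin (orbit_prod window) ?B" by (rule closedin_Int)
      have "closedin (top_of_set window) F"
        using closedin_closed_Int[OF F(2), of window] F(1) by (simp add: Int_absorb1)
      then have cF: "closedin (orbit_prod window) (orbit \<times> F)"
        using topspace_orbit by (simp add: closedin_prod_Times_iff) (metis closedin_topspace)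
      have "?C = topspace (orbit_prod F) - {p \<in> orbit \<times> F. \<Psi> p \<in> O'}"
        unfolding S_def stage_def by (auto simp: topspace_orbit)
      then have "closedin (orbit_prod F) ?C"
        using oF by (simp add: closedin_diff openin_closedin_eq)
      then have "closedin (subtopology (orbit_prod window) (orbit \<times> F)) ?C"
        unfolding prod_topology_top_of_set[OF F(1)] topspace_orbit .
      then have "closedin (orbit_prod window) ?C"
        using cF by (rule closedin_trans_full)
      then have 2: "closedin (orbit_prod window) ?A"
        unfolding split using cB by (rule closedin_Un[rotated])
      have "closedin (subtopology (space_top Z) (E \<inter> V)) S"
        by (rule restricted_final_closed[OF SEV 1 2])
      then obtain T' where T': "closedin (space_top Z) T'" "S = T' \<inter> (E \<inter> V)"
        by (auto simp: closedin_subtopology)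
      have "S = T' \<inter> stage (P \<union> F)"
        using T'(2) stage_subset[of "P \<union> F"] P(1) F(1) unfolding S_def by blast
      then have "closedin (subtopology (space_top Z) (stage (P \<union> F))) S"
        using T'(1) by (auto simp: closedin_subtopology)
      moreover have "O' = topspace (subtopology (space_top Z) (stage (P \<union> F))) - S"
        using O' stZ unfolding S_def by auto
      ultimately show "openin (subtopology (space_top Z) (stage (P \<union> F))) O'"
        by (metis openin_diff openin_topspace)
    qed
  qed
qed

text \<open>
  As every point of the window is interior to some \<open>P k\<close>, openness can be tested on the stages.
\<close>

lemma colimit_of_exhaustion:
  fixes P :: "nat \<Rightarrow> (nat \<Rightarrow> real) set"
  assumes P: "\<And>k. P k \<subseteq> window"
    and exh: "\<And>y. y \<in> window \<Longrightarrow> \<exists>k N. openin (top_of_set window) N \<and> y \<in> N \<and> N \<subseteq> P k"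
  shows "colimit_of_stages (space_top Z) (range (\<lambda>k. stage (P k))) (E \<inter> V)"
  unfolding colimit_of_stages_def
proof (intro conjI allI impI iffI)
  have "window \<subseteq> (\<Union>k. P k)" using exh by blast
  then have "window = (\<Union>k. P k)" using P by blast
  then have "stage window = (\<Union>k. stage (P k))" unfolding stage_def by auto
  then show "E \<inter> V = \<Union>(range (\<lambda>k. stage (P k)))" unfolding stage_window by simp
  fix S assume S: "S \<subseteq> E \<inter> V"
  show "\<forall>T\<in>range (\<lambda>k. stage (P k)). openin (subtopology (space_top Z) T) (S \<inter> T)"
    if "openin (subtopology (space_top Z) (E \<inter> V)) S"
    using openin_subtopology_trans[OF that] stage_subset[OF P] by blast
  assume o: "\<forall>T\<in>range (\<lambda>k. stage (P k)). openin (subtopology (space_top Z) T) (S \<inter> T)"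
  show "openin (subtopology (space_top Z) (E \<inter> V)) S"
  proof (rule restricted_final_open[OF S])
    have "openin (subtopology (space_top Z) (stage (P 0))) (S \<inter> stage (P 0))" using o by blast
    from openin_subtopology_trans[OF this, of "D \<inter> V"]
    have "openin (subtopology (space_top Z) (D \<inter> V)) (S \<inter> stage (P 0) \<inter> (D \<inter> V))"
      unfolding stage_def by blast
    moreover have "S \<inter> stage (P 0) \<inter> (D \<inter> V) = S \<inter> D" using S unfolding stage_def by blast
    ultimately show "openin (subtopology (space_top Z) (D \<inter> V)) (S \<inter> D)" by simp
    show "openin (orbit_prod window) {p \<in> orbit \<times> window. \<Psi> p \<in> S}"
    proof (subst openin_subopen, rule ballI)
      fix p assume "p \<in> {p \<in> orbit \<times> window. \<Psi> p \<in> S}"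
      then obtain c y where p: "p = (c, y)" "c \<in> orbit" "y \<in> window" "\<Psi> (c, y) \<in> S" by auto
      obtain k N where N: "openin (top_of_set window) N" "y \<in> N" "N \<subseteq> P k" using exh[OF p(3)] by blast
      have NW: "N \<subseteq> window" using N(3) P by blast
      obtain T where T: "openin (space_top Z) T" "S \<inter> stage (P k) = T \<inter> stage (P k)"
        using o by (auto simp: openin_subtopology)
      have st: "\<Psi> q \<in> stage (P k)" if "q \<in> orbit \<times> N" for q using that N(3) unfolding stage_def by blast
      have "openin (orbit_prod window) {q \<in> orbit \<times> window. \<Psi> q \<in> T}"
        using openin_continuous_map_preimage[OF continuous_on_orbit_prod[OF window_subset] T(1)]
        by (simp add: topspace_orbit)
      moreover have "openin (orbit_prod window) (orbit \<times> N)"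
        using N(1) topspace_orbit by (simp add: openin_prod_Times_iff) (metis openin_topspace)
      ultimately have "openin (orbit_prod window) ({q \<in> orbit \<times> window. \<Psi> q \<in> T} \<inter> (orbit \<times> N))"
        by (rule openin_Int)
      moreover have "p \<in> {q \<in> orbit \<times> window. \<Psi> q \<in> T} \<inter> (orbit \<times> N)"
        using p N(2) st[of p] T(2) by blast
      moreover have "{q \<in> orbit \<times> window. \<Psi> q \<in> T} \<inter> (orbit \<times> N) \<subseteq> {p \<in> orbit \<times> window. \<Psi> p \<in> S}"
        using st T(2) by blast
      ultimately show "\<exists>T. openin (orbit_prod window) T \<and> p \<in> T \<and> T \<subseteq> {p \<in> orbit \<times> window. \<Psi> p \<in> S}"
        by blast
    qed
  qed
qed

text \<open>
  The relation ``obtainable by attaching cells'' of the dyadic exhaustion is instantiated with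
  cellularity of the corresponding stages, and the resulting sequence is composed.
\<close>

lemma cellular_restriction:
  assumes \<C>: "H \<in> \<C>"
  shows "cellular G \<C> Z (D \<inter> V) (E \<inter> V)"
proof -
  have inv: "invariant G Z (stage P)" if "P \<subseteq> window" for P
    using stage_invariant that window_subset by blast
  have step: "cellular G \<C> Z (stage P) (stage (P \<union> dyadic_face n k x))"
    if x: "x \<in> cube n - cube_frontier n" and F: "dyadic_face n k x \<subseteq> window"
      and P: "window \<inter> cube_frontier n \<subseteq> P" "closedin (top_of_set window) P"
      and L: "cbox_frontier n (dyadic_down k x) (dyadic_up k x) \<subseteq> P"
        "(dyadic_face n k x - cbox_frontier n (dyadic_down k x) (dyadic_up k x)) \<inter> P = {}" for P x k
  proof (cases "stage P = stage (P \<union> dyadic_face n k x)")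
    case True
    then show ?thesis using cellular_refl[OF inv[OF closedin_imp_subset[OF P(2)]]] by metis
  next
    case False
    let ?F = "dyadic_face n k x" and ?L = "cbox_frontier n (dyadic_down k x) (dyadic_up k x)"
    have PW: "P \<subseteq> window" using closedin_imp_subset[OF P(2)] .
    have Z: "stage P \<subseteq> points Z" "stage (P \<union> ?F) \<subseteq> points Z"
      using inv[OF PW] inv[of "P \<union> ?F"] PW F unfolding invariant_def by blast+
    have "?L \<subseteq> ?F" unfolding dyadic_face_def cbox_frontier_def by blast
    then have a: "attaches G H Z (stage P) (stage (P \<union> ?F)) ?F ?L \<Psi>"
      using PW P F L by (intro attaches_face) (auto simp: dyadic_face_def closed_cbox_set)
    obtain f g where fg: "homeomorphism (ball_set (card {i. i < n \<and> dyadic_down k x i < dyadic_up k x i})) ?F f g"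
      "f ` sphere_set (card {i. i < n \<and> dyadic_down k x i < dyadic_up k x i}) = ?L"
      unfolding dyadic_face_def
      by (rule ball_cbox_homeomorphism[where n = n and a = "dyadic_down k x" and b = "dyadic_up k x",
            OF dyadic_down_le_up refl])
    have "cell_attachment G \<C> (gsub Z (stage P)) (gsub Z (stage (P \<union> ?F))) (\<lambda>x. x)"
      by (rule attaches_imp_cell_attachment[OF carrier Z \<C>
            attaches_homeomorphic[OF carrier a fg sphere_subset_ball]])
    moreover have "stage P \<subset> stage (P \<union> ?F)" using False stage_mono[of P "P \<union> ?F"] by blast
    ultimately show ?thesis using inv PW F by (intro cellular_cell) auto
  qed
  obtain P where P: "P 0 = window \<inter> cube_frontier n" "\<And>k. P k \<subseteq> window"
    "\<And>k::nat. cellular G \<C> Z (stage (P k)) (stage (P (Suc k)))"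
    "\<And>y. y \<in> window \<Longrightarrow> \<exists>k N. openin (top_of_set window) N \<and> y \<in> N \<and> N \<subseteq> P k"
  proof (rule dyadic_exhaustion[where R = "\<lambda>P Q. cellular G \<C> Z (stage P) (stage Q)", OF openin_window])
    show "cellular G \<C> Z (stage P) (stage P)" if "P \<subseteq> window" for P
      by (rule cellular_refl[OF inv[OF that]])
    show "cellular G \<C> Z (stage P) (stage P'')"
      if "cellular G \<C> Z (stage P) (stage P')" "cellular G \<C> Z (stage P') (stage P'')" for P P' P''
      using that by (rule cellular_trans)
  qed (erule (5) step, rule that)
  have "cellular G \<C> Z (stage (P 0)) (E \<inter> V)"
    by (rule cellular_sequence[where Y = "\<lambda>k. stage (P k)", OF P(3) colimit_of_exhaustion[OF P(2,4)]])
  then show ?thesis unfolding P(1) stage_frontier .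
qed

end

section \<open>Restricting chains to open invariant sets\<close>

lemma openin_open_cut:
  assumes V: "openin X V" and o: "openin (subtopology X (T \<inter> V)) (S \<inter> T)" and S: "S \<subseteq> V"
  shows "openin (subtopology X T) (S \<inter> T)"
proof -
  obtain W where W: "openin X W" "S \<inter> T = W \<inter> (T \<inter> V)"
    using o by (auto simp: openin_subtopology)
  then have "S \<inter> T = (W \<inter> V) \<inter> T" by blast
  then show ?thesis using W(1) V by (auto simp: openin_subtopology)
qed

lemma colimit_of_stages_open:
  assumes colim: "colimit_of_stages X \<D> T" and V: "openin X V"
  shows "colimit_of_stages X ((\<lambda>D. D \<inter> V) ` \<D>) (T \<inter> V)"
  unfolding colimit_of_stages_def
proof (intro conjI allI impI iffI ballI)
  have T: "T = \<Union>\<D>"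
    and final: "\<forall>S\<subseteq>T. openin (subtopology X T) S \<longleftrightarrow> (\<forall>D\<in>\<D>. openin (subtopology X D) (S \<inter> D))"
    using colim unfolding colimit_of_stages_def by (rule conjunct1, rule conjunct2)
  show "T \<inter> V = \<Union>((\<lambda>D. D \<inter> V) ` \<D>)" using T by blast
  fix S assume S: "S \<subseteq> T \<inter> V"
  show "openin (subtopology X D') (S \<inter> D')"
    if "openin (subtopology X (T \<inter> V)) S" "D' \<in> (\<lambda>D. D \<inter> V) ` \<D>" for D'
    by (rule openin_subtopology_trans[OF that(1)]) (use that(2) T in auto)
  assume o: "\<forall>D'\<in>(\<lambda>D. D \<inter> V) ` \<D>. openin (subtopology X D') (S \<inter> D')"
  have "openin (subtopology X D) (S \<inter> D)" if "D \<in> \<D>" for D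
  proof (rule openin_open_cut[OF V])
    have "S \<inter> (D \<inter> V) = S \<inter> D" using S by blast
    then show "openin (subtopology X (D \<inter> V)) (S \<inter> D)" using o that by force
  qed (use S in blast)
  then have "openin (subtopology X T) S" using final S by simp
  from openin_subtopology_trans[OF this, of "T \<inter> V"] show "openin (subtopology X (T \<inter> V)) S"
    using S by (simp add: Int_absorb2)
qed

lemma cell_attachment_open_cellular:
  assumes group: "group G" and carrier: "topspace (gtopology G) = carrier G"
    and \<C>: "\<And>H. H \<in> \<C> \<Longrightarrow> subgroup H G"
    and D: "invariant G Z D" and E: "invariant G Z E"
    and cell: "cell_attachment G \<C> (gsub Z D) (gsub Z E) (\<lambda>x. x)"
    and V: "openin (space_top Z) V" "invariant G Z V"
  shows "cellular G \<C> Z (D \<inter> V) (E \<inter> V)"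
proof -
  have DE: "D \<subseteq> points Z" "E \<subseteq> points Z" using D E unfolding invariant_def by auto
  obtain H n \<Phi> where HC: "H \<in> \<C>" and a: "attaches G H Z D E (ball_set n) (sphere_set n) \<Phi>"
    using cell_attachment_imp_attaches[OF carrier DE cell] by blast
  obtain f g where fg: "homeomorphism (ball_set n) (cube n) f g" "f ` sphere_set n = cube_frontier n"
    by (rule ball_cube_homeomorphism)
  have "g ` cube_frontier n = sphere_set n"
    using homeomorphism_apply1[OF fg(1)] sphere_subset_ball[of n] unfolding fg(2)[symmetric] image_image
    by (auto simp: subset_iff image_iff)
  moreover have "cube_frontier n \<subseteq> cube n" unfolding cbox_frontier_def by blast
  ultimately have "attaches G H Z D E (cube n) (cube_frontier n) (\<lambda>(c, y). \<Phi> (c, g y))"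
    by (rule attaches_homeomorphic[OF carrier a homeomorphism_symD[OF fg(1)]])
  then interpret open_in_attached_cell G H Z D E V n "\<lambda>(c, y). \<Phi> (c, g y)"
    by (rule open_in_attached_cell.intro[OF group carrier \<C>[OF HC] D E _ V])
  show ?thesis using HC by (rule cellular_restriction)
qed

lemma invariant_Int: "invariant G X S \<Longrightarrow> invariant G X T \<Longrightarrow> invariant G X (S \<inter> T)"
  unfolding invariant_def by auto

text \<open>
  Intersecting all stages with \<open>V\<close> gives a chain to which the composition lemma applies, except that
  different stages may have the same intersection. Each intersection is therefore represented by the
  least stage \<open>T\<close> that produces it; then every stage strictly below \<open>T\<close> has a strictly smaller
  intersection, so successors and limits keep their roles.
\<close>

lemma filtration_open_cellular:
  assumes group: "group G" and carrier: "topspace (gtopology G) = carrier G"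
    and \<C>: "\<And>H. H \<in> \<C> \<Longrightarrow> subgroup H G"
    and F: "filtration G \<C> Z \<F> D E"
    and V: "openin (space_top Z) V" "invariant G Z V"
  shows "cellular G \<C> Z (D \<inter> V) (E \<inter> V)"
proof (rule cellular_composition[of "(\<lambda>T. T \<inter> V) ` \<F>"])
  note F' = filtrationD[OF F]
  show "D \<inter> V \<in> (\<lambda>T. T \<inter> V) ` \<F>" "E \<inter> V \<in> (\<lambda>T. T \<inter> V) ` \<F>"
    using F'(3,4) by auto
  show "D \<inter> V \<subseteq> S" "S \<subseteq> E \<inter> V" if "S \<in> (\<lambda>T. T \<inter> V) ` \<F>" for S
    using that F'(5,6) by blast+
  show "invariant G Z S" if "S \<in> (\<lambda>T. T \<inter> V) ` \<F>" for S
    using that F'(1) V(2) invariant_Int by fastforce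
  have least: "\<exists>T\<in>\<F>. P T \<and> (\<forall>T'\<in>\<F>. P T' \<longrightarrow> T \<subseteq> T')" if "\<exists>T\<in>\<F>. P T" for P
  proof -
    have "\<exists>T\<in>{T \<in> \<F>. P T}. \<forall>T'\<in>{T \<in> \<F>. P T}. T \<subseteq> T'"
      by (rule F'(2)) (use that in auto)
    then show ?thesis by auto
  qed
  have total: "T \<subseteq> T' \<or> T' \<subseteq> T" if "T \<in> \<F>" "T' \<in> \<F>" for T T'
    using F'(2)[of "{T, T'}"] that by auto
  show "\<exists>T\<in>\<T>. \<forall>T'\<in>\<T>. T \<subseteq> T'" if \<T>: "\<T> \<subseteq> (\<lambda>T. T \<inter> V) ` \<F>" "\<T> \<noteq> {}" for \<T>
  proof -
    obtain T where "T \<in> \<F>" "T \<inter> V \<in> \<T>" "\<And>T'. T' \<in> \<F> \<Longrightarrow> T' \<inter> V \<in> \<T> \<Longrightarrow> T \<subseteq> T'"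
      using least[of "\<lambda>T. T \<inter> V \<in> \<T>"] \<T> by blast
    then show ?thesis using \<T>(1) by (intro bexI[of _ "T \<inter> V"]) blast+
  qed
  fix S assume "S \<in> (\<lambda>T. T \<inter> V) ` \<F>"
  then have "\<exists>T\<in>\<F>. S = T \<inter> V" by auto
  from least[OF this]
  obtain T where T: "T \<in> \<F>" "S = T \<inter> V" and min: "\<And>T'. T' \<in> \<F> \<Longrightarrow> S = T' \<inter> V \<Longrightarrow> T \<subseteq> T'"
    by auto
  have below: "T' \<subset> T" if "T' \<in> \<F>" "T' \<inter> V \<subset> S" for T'
    using total[OF T(1) that(1)] that(2) T(2) by blast
  have strict: "T' \<inter> V \<subset> S" if "T' \<in> \<F>" "T' \<subset> T" for T'
    using min[OF that(1)] that(2) T(2) by blast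
  consider "T = D"
    | D' where "successor_stage \<F> D' T" "cell_attachment G \<C> (gsub Z D') (gsub Z T) (\<lambda>x. x)"
    | "colimit_of_stages (space_top Z) {T' \<in> \<F>. T' \<subset> T} T"
    using F'(7)[OF T(1)] by blast
  then show "S = D \<inter> V \<or>
      (\<exists>D'. successor_stage ((\<lambda>T. T \<inter> V) ` \<F>) D' S \<and> cellular G \<C> Z D' S) \<or>
      colimit_of_stages (space_top Z) {D' \<in> (\<lambda>T. T \<inter> V) ` \<F>. D' \<subset> S} S"
  proof cases
    case 1
    then show ?thesis using T(2) by simp
  next
    case 2
    from 2(1) have D': "D' \<in> \<F>" "D' \<subset> T" "\<And>T'. T' \<in> \<F> \<Longrightarrow> T' \<subset> T \<Longrightarrow> T' \<subseteq> D'"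
      unfolding successor_stage_def by simp_all
    have "S' \<subseteq> D' \<inter> V" if S': "S' \<in> (\<lambda>T. T \<inter> V) ` \<F>" "S' \<subset> S" for S'
    proof -
      obtain T' where T': "T' \<in> \<F>" "S' = T' \<inter> V" using S'(1) by blast
      then have "T' \<subseteq> D'" using D'(3)[OF T'(1) below[OF T'(1)]] S'(2) by simp
      then show ?thesis using T'(2) by blast
    qed
    then have "successor_stage ((\<lambda>T. T \<inter> V) ` \<F>) (D' \<inter> V) S"
      using strict[OF D'(1,2)] D'(1) T unfolding successor_stage_def by simp
    moreover have "cellular G \<C> Z (D' \<inter> V) S"
      unfolding T(2)
      by (rule cell_attachment_open_cellular[OF group carrier \<C> F'(1)[OF D'(1)] F'(1)[OF T(1)] 2(2) V])
    ultimately show ?thesis by (intro disjI2 disjI1 exI conjI)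
  next
    case 3
    have "{D' \<in> (\<lambda>T. T \<inter> V) ` \<F>. D' \<subset> S} = (\<lambda>T. T \<inter> V) ` {T' \<in> \<F>. T' \<subset> T}"
    proof (intro subset_antisym subsetI)
      fix S' assume "S' \<in> {D' \<in> (\<lambda>T. T \<inter> V) ` \<F>. D' \<subset> S}"
      then obtain T' where "T' \<in> \<F>" "S' = T' \<inter> V" "S' \<subset> S" by blast
      then show "S' \<in> (\<lambda>T. T \<inter> V) ` {T' \<in> \<F>. T' \<subset> T}" using below by simp
    next
      fix S' assume "S' \<in> (\<lambda>T. T \<inter> V) ` {T' \<in> \<F>. T' \<subset> T}"
      then show "S' \<in> {D' \<in> (\<lambda>T. T \<inter> V) ` \<F>. D' \<subset> S}" using strict by auto
    qed
    then have "colimit_of_stages (space_top Z) {D' \<in> (\<lambda>T. T \<inter> V) ` \<F>. D' \<subset> S} S"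
      using colimit_of_stages_open[OF 3 V(1)] T(2) by simp
    then show ?thesis by (rule disjI2[OF disjI2])
  qed
qed

section \<open>Open invariant subspaces\<close>

lemma test_map_subtopology: "test_map K (subtopology X S) f \<longleftrightarrow> test_map K X f \<and> f ` topspace K \<subseteq> S"
  unfolding test_map_def continuous_map_in_subtopology by auto

lemma weak_Hausdorff_subtopology:
  assumes "weak_Hausdorff X"
  shows "weak_Hausdorff (subtopology X S)"
  unfolding weak_Hausdorff_def
proof (intro allI impI)
  fix K :: "'a set set topology" and f
  assume "test_map K (subtopology X S) f"
  then have f: "closedin X (f ` topspace K)" "f ` topspace K \<subseteq> S"
    using assms unfolding test_map_subtopology weak_Hausdorff_def by blast+
  then show "closedin (subtopology X S) (f ` topspace K)"
    unfolding closedin_subtopology by blast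
qed

text \<open>
  A test map into \<open>X\<close> can be localised: near a point mapped into \<open>V\<close>, compact Hausdorff spaces being
  regular, there is a closed neighbourhood whose image lies in \<open>V\<close>, and it is again compact Hausdorff.
  Thus a set with closed preimages under all test maps into \<open>V\<close> has an open complement in \<open>V\<close>, as seen
  by the test maps into \<open>X\<close>.
\<close>

lemma compactly_generated_open:
  fixes X :: "'x topology"
  assumes cg: "compactly_generated X" and V: "openin X V"
  shows "compactly_generated (subtopology X V)"
  unfolding compactly_generated_def
proof (intro allI impI)
  fix S assume "S \<subseteq> topspace (subtopology X V)"
    and test: "\<forall>(K :: 'x set set topology) f. test_map K (subtopology X V) f \<longrightarrow>
      closedin K {k \<in> topspace K. f k \<in> S}"
  then have S: "S \<subseteq> V" by auto
  have VX: "V \<subseteq> topspace X" using openin_subset[OF V] .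
  have "closedin X (topspace X - (V - S))"
  proof (rule cg[unfolded compactly_generated_def, rule_format])
    fix K :: "'x set set topology" and f assume f: "test_map K X f"
    have cont: "continuous_map K X f" and reg: "regular_space K"
      using f compact_Hausdorff_imp_regular_space unfolding test_map_def by blast+
    have "openin K {k \<in> topspace K. f k \<in> V - S}"
    proof (subst openin_subopen, rule ballI)
      fix k assume k: "k \<in> {k \<in> topspace K. f k \<in> V - S}"
      have "openin K {k \<in> topspace K. f k \<in> V}"
        by (rule openin_continuous_map_preimage[OF cont V])
      moreover have "k \<in> {k \<in> topspace K. f k \<in> V}" using k by simp
      ultimately have "\<exists>O' N. openin K O' \<and> closedin K N \<and> k \<in> O' \<and> O' \<subseteq> N \<and> N \<subseteq> {k \<in> topspace K. f k \<in> V}"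
        using reg[folded neighbourhood_base_of_closedin, unfolded neighbourhood_base_of] by simp
      then obtain O' N where N: "openin K O'" "closedin K N" "k \<in> O'" "O' \<subseteq> N" "N \<subseteq> {k \<in> topspace K. f k \<in> V}"
        by (elim exE conjE)
      have NK: "N \<subseteq> topspace K" using closedin_subset[OF N(2)] .
      have "test_map (subtopology K N) (subtopology X V) f"
        using f N(2,5) closedin_compact_space[of K N]
        unfolding test_map_subtopology unfolding test_map_def
        by (auto intro: continuous_map_from_subtopology Hausdorff_space_subtopology compact_space_subtopology)
      then have "closedin (subtopology K N) {k \<in> topspace (subtopology K N). f k \<in> S}"
        using test by blast
      then have "closedin K {k \<in> topspace (subtopology K N). f k \<in> S}"
        using N(2) by (rule closedin_trans_full)
      moreover have "{k \<in> topspace (subtopology K N). f k \<in> S} = {k \<in> N. f k \<in> S}" using NK by auto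
      ultimately have "openin K (O' - {k \<in> N. f k \<in> S})" using N(1) openin_diff by metis
      moreover have "O' - {k \<in> N. f k \<in> S} \<subseteq> {k \<in> topspace K. f k \<in> V - S}" using N(4,5) by blast
      moreover have "k \<in> O' - {k \<in> N. f k \<in> S}" using N(3) k by blast
      ultimately show "\<exists>T. openin K T \<and> k \<in> T \<and> T \<subseteq> {k \<in> topspace K. f k \<in> V - S}" by blast
    qed
    moreover have "{k \<in> topspace K. f k \<in> topspace X - (V - S)} = topspace K - {k \<in> topspace K. f k \<in> V - S}"
      using continuous_map_image_subset_topspace[OF cont] by blast
    ultimately show "closedin K {k \<in> topspace K. f k \<in> topspace X - (V - S)}"
      by (simp add: closedin_diff)
  qed blast
  moreover have "S = (topspace X - (V - S)) \<inter> V" using S VX by blast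
  ultimately show "closedin (subtopology X V) S" unfolding closedin_subtopology by blast
qed

lemma is_gspace_open:
  assumes X: "is_gspace G X" and V: "openin (space_top X) V" "invariant G X V"
    and carrier: "topspace (gtopology G) = carrier G"
  shows "is_gspace G (gsub X V)"
proof -
  have VX: "V \<subseteq> points X" and act: "\<And>g x. g \<in> carrier G \<Longrightarrow> x \<in> V \<Longrightarrow> act X g x \<in> V"
    using V(2) unfolding invariant_def by auto
  have "continuous_map (prod_topology (gtopology G) (subtopology (space_top X) V)) (subtopology (space_top X) V)
      (\<lambda>(g, x). act X g x)"
    using X act unfolding is_gspace_def
    by (auto simp: continuous_map_in_subtopology prod_topology_subtopology carrier
        intro: continuous_map_from_subtopology)
  then show ?thesis
    using X VX compactly_generated_open[OF _ V(1)] weak_Hausdorff_subtopology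
    unfolding is_gspace_def gsub_def by auto
qed

lemma preimage_open_invariant:
  assumes f: "gmap G X Y f" and X: "is_gspace G X" and V: "openin (space_top Y) V" "invariant G Y V"
    and carrier: "topspace (gtopology G) = carrier G"
  shows "openin (space_top X) {x \<in> points X. f x \<in> V}" "invariant G X {x \<in> points X. f x \<in> V}"
proof -
  show "openin (space_top X) {x \<in> points X. f x \<in> V}"
    using f V(1) unfolding gmap_def by (auto intro: openin_continuous_map_preimage)
  have act: "act X g x \<in> points X" if "g \<in> carrier G" "x \<in> points X" for g x
  proof -
    have "continuous_map (prod_topology (gtopology G) (space_top X)) (space_top X) (\<lambda>(g, x). act X g x)"
      using X unfolding is_gspace_def by blast
    from continuous_map_image_subset_topspace[OF this] show ?thesis
      using that carrier by auto
  qed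
  have "f (act X g x) = act Y g (f x)" if "g \<in> carrier G" "x \<in> points X" for g x
    using f that unfolding gmap_def by blast
  then show "invariant G X {x \<in> points X. f x \<in> V}"
    using act V(2) unfolding invariant_def by auto
qed

lemma gmap_gsub:
  assumes "gmap G X Y f" "S \<subseteq> points X" "\<And>x. x \<in> S \<Longrightarrow> f x \<in> T"
  shows "gmap G (gsub X S) (gsub Y T) f"
  using assms unfolding gmap_def gsub_def
  by (auto simp: continuous_map_in_subtopology intro: continuous_map_from_subtopology)

lemma gsub_gsub: "S \<subseteq> V \<Longrightarrow> gsub (gsub X V) S = gsub X S"
  unfolding gsub_def by (simp add: subtopology_subtopology Int_absorb1)

text \<open>
  The ambient space of a filtration may be replaced by its last stage, which turns a cellular
  inclusion into a relative cell complex.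
\<close>

lemma filtration_gsub:
  assumes F: "filtration G \<C> Z \<F> D V"
  shows "filtration G \<C> (gsub Z V) \<F> D V"
proof -
  have sub: "T \<subseteq> V" if "T \<in> \<F>" for T using filtrationD(6)[OF F that] .
  have VZ: "V \<subseteq> points Z" using filtrationD(1,4)[OF F] unfolding invariant_def by blast
  have act: "act (gsub Z V) = act Z" unfolding gsub_def by simp
  have inv: "invariant G (gsub Z V) T" if "T \<in> \<F>" for T
    using filtrationD(1)[OF F that] sub[OF that] points_gsub[OF VZ] unfolding invariant_def act by simp
  have top: "subtopology (space_top (gsub Z V)) T = subtopology (space_top Z) T" if "T \<subseteq> V" for T
    using that unfolding gsub_def by (simp add: subtopology_subtopology Int_absorb1)
  have colim: "colimit_of_stages (space_top (gsub Z V)) {T' \<in> \<F>. T' \<subset> T} T"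
    if c: "colimit_of_stages (space_top Z) {T' \<in> \<F>. T' \<subset> T} T" and T: "T \<in> \<F>" for T
  proof -
    have "\<forall>T'\<in>{T' \<in> \<F>. T' \<subset> T}. subtopology (space_top (gsub Z V)) T' = subtopology (space_top Z) T'"
      using top sub by blast
    then show ?thesis
      using c unfolding colimit_of_stages_def top[OF sub[OF T]] by simp
  qed
  have cell: "cell_attachment G \<C> (gsub (gsub Z V) T') (gsub (gsub Z V) T) (\<lambda>x. x)"
    if "successor_stage \<F> T' T" "cell_attachment G \<C> (gsub Z T') (gsub Z T) (\<lambda>x. x)" for T T'
    using that sub gsub_gsub unfolding successor_stage_def by metis
  show ?thesis
    unfolding filtration_def
  proof (intro conjI ballI allI impI)
    fix T assume T: "T \<in> \<F>"
    show "T = D \<or> (\<exists>T'. successor_stage \<F> T' T \<and>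
          cell_attachment G \<C> (gsub (gsub Z V) T') (gsub (gsub Z V) T) (\<lambda>x. x)) \<or>
        colimit_of_stages (space_top (gsub Z V)) {T' \<in> \<F>. T' \<subset> T} T"
      using filtrationD(7)[OF F T] cell[of _ T] colim[OF _ T] by blast
  qed (use filtrationD[OF F] inv in auto)
qed

lemma relative_cell_complex_iff:
  "relative_cell_complex G \<C> A Z j \<longleftrightarrow>
     is_gspace G A \<and> is_gspace G Z \<and> gmap G A Z j \<and> embedding_map (space_top A) (space_top Z) j \<and>
     (\<exists>\<F>. filtration G \<C> Z \<F> (j ` points A) (points Z))"
proof -
  have top: "(\<forall>T\<in>\<F>. j ` points A \<subseteq> T \<and> T \<subseteq> points Z) \<longleftrightarrow> (\<forall>T\<in>\<F>. j ` points A \<subseteq> T)"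
    if "\<forall>T\<in>\<F>. invariant G Z T" for \<F>
    using that unfolding invariant_def by blast
  show ?thesis
  proof
    assume "relative_cell_complex G \<C> A Z j"
    then show "is_gspace G A \<and> is_gspace G Z \<and> gmap G A Z j \<and>
        embedding_map (space_top A) (space_top Z) j \<and>
        (\<exists>\<F>. filtration G \<C> Z \<F> (j ` points A) (points Z))"
      unfolding relative_cell_complex_def filtration_def
      by (elim conjE exE) (intro conjI exI, (assumption | (subst top; assumption))+)
  next
    assume "is_gspace G A \<and> is_gspace G Z \<and> gmap G A Z j \<and>
        embedding_map (space_top A) (space_top Z) j \<and>
        (\<exists>\<F>. filtration G \<C> Z \<F> (j ` points A) (points Z))"
    then show "relative_cell_complex G \<C> A Z j"
      unfolding relative_cell_complex_def filtration_def
      by (elim conjE exE) (intro conjI exI, (assumption | (subst top[symmetric]; assumption))+)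
  qed
qed

lemma embedding_map_preimage:
  assumes e: "embedding_map X Y j" and V: "V \<subseteq> topspace Y"
  shows "embedding_map (subtopology X {x \<in> topspace X. j x \<in> V}) (subtopology Y V) j"
proof -
  have "homeomorphic_map X (subtopology Y (j ` topspace X)) j"
    using e unfolding embedding_map_def .
  then have "homeomorphic_map (subtopology X {x \<in> topspace X. j x \<in> V})
      (subtopology (subtopology Y (j ` topspace X)) V) j"
    by (rule homeomorphic_map_subtopologies) (use V in auto)
  moreover have "subtopology (subtopology Y (j ` topspace X)) V =
      subtopology (subtopology Y V) (j ` topspace (subtopology X {x \<in> topspace X. j x \<in> V}))"
    unfolding subtopology_subtopology by (rule arg_cong[where f = "subtopology Y"]) auto
  ultimately show ?thesis unfolding embedding_map_def by simp
qed

lemma relative_cell_complex_open: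
  assumes group: "group G" and carrier: "topspace (gtopology G) = carrier G"
    and \<C>: "\<And>H. H \<in> \<C> \<Longrightarrow> subgroup H G"
    and cx: "relative_cell_complex G \<C> A Z j"
    and V: "openin (space_top Z) V" "invariant G Z V"
  shows "relative_cell_complex G \<C> (gsub A {a \<in> points A. j a \<in> V}) (gsub Z V) j"
proof -
  let ?A = "{a \<in> points A. j a \<in> V}"
  have A: "is_gspace G A" and Z: "is_gspace G Z" and j: "gmap G A Z j"
    and emb: "embedding_map (space_top A) (space_top Z) j"
    and F: "\<exists>\<F>. filtration G \<C> Z \<F> (j ` points A) (points Z)"
    using cx unfolding relative_cell_complex_iff by blast+
  have VZ: "V \<subseteq> points Z" using V(2) unfolding invariant_def by blast
  have pA: "points (gsub A ?A) = ?A" by (rule points_gsub) blast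
  have "cellular G \<C> Z (j ` points A \<inter> V) (points Z \<inter> V)"
    using F filtration_open_cellular[OF group carrier \<C> _ V] by blast
  moreover have "j ` points A \<inter> V = j ` ?A" by blast
  ultimately have "\<exists>\<F>. filtration G \<C> (gsub Z V) \<F> (j ` ?A) V"
    using VZ filtration_gsub unfolding cellular_def by (metis Int_absorb1)
  moreover have "is_gspace G (gsub A ?A)"
    using is_gspace_open[OF A] preimage_open_invariant[OF j A V carrier] carrier by blast
  moreover have "is_gspace G (gsub Z V)" by (rule is_gspace_open[OF Z V carrier])
  moreover have "gmap G (gsub A ?A) (gsub Z V) j" by (rule gmap_gsub[OF j]) auto
  moreover have "embedding_map (space_top (gsub A ?A)) (space_top (gsub Z V)) j"
    using embedding_map_preimage[OF emb VZ] unfolding gsub_def by simp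
  ultimately show ?thesis
    unfolding relative_cell_complex_iff pA points_gsub[OF VZ] by blast
qed

section \<open>Restriction of cofibrations\<close>

theorem lemma2p4:
  fixes G :: "'g topgroup" and \<C> :: "'g set set"
    and A :: "('g, 'a) gspace" and B :: "('g, 'b) gspace" and i :: "'a \<Rightarrow> 'b" and U :: "'b set"
  assumes "compact_Lie_group G"
    and "\<And>H. H \<in> \<C> \<Longrightarrow> subgroup H G \<and> closedin (gtopology G) H"
    and "\<And>H g. H \<in> \<C> \<Longrightarrow> g \<in> carrier G \<Longrightarrow> (g <#\<^bsub>G\<^esub> H) #>\<^bsub>G\<^esub> inv\<^bsub>G\<^esub> g \<in> \<C>"
    and "cofibration TYPE('z) G \<C> A B i"
    and "openin (space_top B) U" and "invariant G B U"
  shows "cofibration TYPE('z) G \<C> (gsub A {a \<in> points A. i a \<in> U}) (gsub B U) i"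
proof -
  have group: "group G" and carrier: "topspace (gtopology G) = carrier G"
    using assms(1) unfolding compact_Lie_group_def Lie_group_def by blast+
  have sub: "\<And>H. H \<in> \<C> \<Longrightarrow> subgroup H G" using assms(2) by blast
  note U = assms(5,6)
  obtain C :: "('g, 'z) gspace" and Z :: "('g, 'z) gspace" and j s r s' r' where
    gA: "is_gspace G A" and gB: "is_gspace G B" and i: "gmap G A B i" and
    cx: "relative_cell_complex G \<C> C Z j" and
    maps: "gmap G A C s" "gmap G C A r" "gmap G B Z s'" "gmap G Z B r'" and
    retr: "\<forall>a\<in>points A. r (s a) = a" "\<forall>b\<in>points B. r' (s' b) = b" and
    comm: "\<forall>a\<in>points A. j (s a) = s' (i a)" "\<forall>c\<in>points C. i (r c) = r' (j c)"
    using assms(4) unfolding cofibration_def by blast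
  have gZ: "is_gspace G Z" and j: "gmap G C Z j" using cx unfolding relative_cell_complex_def by blast+
  \<comment> \<open>The four maps of the retract restrict to the preimages of \<open>U\<close>, by commutativity and retraction.\<close>
  define V where "V = {z \<in> points Z. r' z \<in> U}"
  have V: "openin (space_top Z) V" "invariant G Z V"
    unfolding V_def by (rule preimage_open_invariant[OF maps(4) gZ U carrier])+
  let ?A = "{a \<in> points A. i a \<in> U}" and ?C = "{c \<in> points C. j c \<in> V}"
  have UB: "U \<subseteq> points B" using U(2) unfolding invariant_def by blast
  have VZ: "V \<subseteq> points Z" unfolding V_def by blast
  have p: "points (gsub A ?A) = ?A" "points (gsub C ?C) = ?C" "points (gsub B U) = U" "points (gsub Z V) = V"
    by (rule points_gsub, use UB VZ in blast)+
  have mem: "a \<in> points A \<Longrightarrow> s a \<in> points C" "c \<in> points C \<Longrightarrow> r c \<in> points A"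
    "b \<in> points B \<Longrightarrow> s' b \<in> points Z" "c \<in> points C \<Longrightarrow> j c \<in> points Z" for a b c
    using maps j unfolding gmap_def by (auto simp: continuous_map_def Pi_iff)
  have s': "s' b \<in> V" if "b \<in> U" for b
    using that UB mem(3) retr(2) unfolding V_def by auto
  have cx': "relative_cell_complex G \<C> (gsub C ?C) (gsub Z V) j"
    by (rule relative_cell_complex_open[OF group carrier sub cx V])
  have sg: "gmap G (gsub A ?A) (gsub C ?C) s"
  proof (rule gmap_gsub[OF maps(1)])
    show "s a \<in> ?C" if "a \<in> ?A" for a using that mem(1) comm(1) s' by auto
  qed blast
  have rg: "gmap G (gsub C ?C) (gsub A ?A) r"
  proof (rule gmap_gsub[OF maps(2)])
    show "r c \<in> ?A" if "c \<in> ?C" for c using that mem(2) comm(2) unfolding V_def by auto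
  qed blast
  have s'g: "gmap G (gsub B U) (gsub Z V) s'" by (rule gmap_gsub[OF maps(3) UB s'])
  have r'g: "gmap G (gsub Z V) (gsub B U) r'"
    by (rule gmap_gsub[OF maps(4) VZ]) (simp add: V_def)
  have ig: "gmap G (gsub A ?A) (gsub B U) i" by (rule gmap_gsub[OF i]) auto
  have A': "is_gspace G (gsub A ?A)"
    by (rule is_gspace_open[OF gA preimage_open_invariant[OF i gA U carrier] carrier])
  have B': "is_gspace G (gsub B U)" by (rule is_gspace_open[OF gB U carrier])
  show ?thesis
    unfolding cofibration_def p
  proof (intro conjI exI)
    show "relative_cell_complex G \<C> (gsub C ?C) (gsub Z V) j" by (rule cx')
  qed (use A' B' ig sg rg s'g r'g retr comm UB p in auto)
qed

end
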